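(* Let $\Phi = (A; \{E_i\}_{i=0}^d; A^*; \{E^*_i\}_{i=0}^d)$ be a self-dual Leonard system on $V$ with parameter array $(\{\theta_i\}_{i=0}^d; \{\theta^*_i\}_{i=0}^d; \{\varphi_i\}_{i=1}^d; \{\phi_i\}_{i=1}^d)$. Let $T = \sum_{i=0}^d \eta_{d-i}(A) E^*_0 E_d \tau^*_i(A^* )$. Let $v_0\in E_0V$, $v_d\in E_dV$, $v_0^*\in E_0^*V$, $v_d^*\in E_d^*V$ be nonzero vectors. Then with respect to each of the four bases $$\{\eta^*_i(A^* )v_0\}_{i=0}^d,\qquad \{\eta_i(A)v^*_0\}_{i=0}^d,\qquad \{\tau^*_i(A^* )v_d\}_{i=0}^d,\qquad \{\tau_i(A)v^*_d\}_{i=0}^d$$ of $V$, the matrix representing $T$ is $$\frac{\varphi_1\cdots\varphi_d}{\tau_d(\theta_d)\,\eta_d(\theta_0)}\begin{pmatrix} \mathbf{0} & & & & & \phi_1\cdots\phi_d\\ & & & & \cdot & \\ & & & \cdot & & \\ & & \phi_1\phi_2 & & & \\ & \phi_1 & & & & \\ 1 & & & & & \mathbf{0}\end{pmatrix},$$ i.e. the $(d+1)\times(d+1)$ matrix (rows and columns indexed by $0,1,\dots,d$) which is the displayed scalar times the matrix whose $(d-j,j)$-entry is $\phi_1\phi_2\cdots\phi_j$ for $0\le j\le d$ and whose other entries are all $0$.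
   Context: Let $\mathbb{F}$ be a field and $V$ a vector space over $\mathbb{F}$ with finite positive dimension; $\mathrm{End}(V)$ is the $\mathbb{F}$-algebra of $\mathbb{F}$-linear maps $V\to V$. A matrix $Y$ represents $X\in\mathrm{End}(V)$ with respect to a basis $\{u_i\}_{i=0}^d$ if $Xu_j=\sum_{i=0}^d Y_{i,j}u_i$ for $0\le j\le d$. A square matrix is tridiagonal if each nonzero entry lies on the diagonal, subdiagonal or superdiagonal; a tridiagonal matrix is irreducible if every subdiagonal entry and every superdiagonal entry is nonzero. A Leonard pair on $V$ is an ordered pair $A, A^*$ of elements of $\mathrm{End}(V)$ (the symbol $A^*$ does not denote an adjoint) such that (i) there is a basis of $V$ with respect to which $A$ is represented by an irreducible tridiagonal matrix and $A^*$ by a diagonal matrix; (ii) there is a basis of $V$ with respect to which $A^*$ is represented by an irreducible tridiagonal matrix and $A$ by a diagonal matrix. For a Leonard pair each of $A$, $A^*$ is multiplicity-free (diagonalizable with all eigenspaces of dimension one). For a multiplicity-free element, its primitive idempotents are the projections onto its eigenspaces (identity on one eigenspace, zero on the others). An ordering $\{E_i\}_{i=0}^d$ of the primitive idempotents of $A$ is standard if, for $0\neq w_i\in E_iV$, the matrix representing $A^*$ with respect to the basis $\{w_i\}_{i=0}^d$ is irreducible tridiagonal; a standard ordering of the primitive idempotents of $A^*$ is defined similarly with the roles of $A,A^*$ swapped. A Leonard system on $V$ is a sequence $\Phi=(A;\{E_i\}_{i=0}^d;A^*;\{E_i^*\}_{i=0}^d)$ where $A,A^*$ is a Leonard pair on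 $V$ and $\{E_i\}_{i=0}^d$, $\{E^*_i\}_{i=0}^d$ are standard orderings of the primitive idempotents of $A$, $A^*$ respectively (so $\dim V=d+1$). Let $\theta_i$ (resp. $\theta^*_i$) be the eigenvalue of $A$ (resp. $A^*$) corresponding to $E_i$ (resp. $E_i^*$). $\Phi$ is self-dual if there is an $\mathbb{F}$-algebra automorphism $\sigma$ of $\mathrm{End}(V)$ sending $A\mapsto A^*$, $A^*\mapsto A$, $E_i\mapsto E^*_i$, $E_i^*\mapsto E_i$ $(0\le i\le d)$. For $0\le i\le d$ define polynomials $\tau_i=(x-\theta_0)(x-\theta_1)\cdots(x-\theta_{i-1})$, $\eta_i=(x-\theta_d)(x-\theta_{d-1})\cdots(x-\theta_{d-i+1})$, $\tau_i^*=(x-\theta^*_0)\cdots(x-\theta^*_{i-1})$, $\eta_i^*=(x-\theta^*_d)\cdots(x-\theta^*_{d-i+1})$ (empty products are $1$). Parameter array: for $0\ne v\in E_0^*V$ the vectors $u_i=\tau_i(A)v$ $(0\le i\le d)$ form a basis of $V$, and there are unique nonzero scalars $\{\varphi_i\}_{i=1}^d$ in $\mathbb{F}$ (the first split sequence, independent of $v$) with $A^*u_0=\theta^*_0u_0$ and $A^*u_i=\theta_i^*u_i+\varphi_iu_{i-1}$ $(1\le i\le d)$. Likewise the vectors $u'_i=\eta_i(A)v$ form a basis of $V$, and there are unique nonzero scalars $\{\phi_i\}_{i=1}^d$ in $\mathbb{F}$ (the second split sequence) with $A^*u'_0=\theta^*_0u'_0$ and $A^*u'_i=\theta^*_iu'_i+\phi_iu'_{i-1}$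 $(1\le i\le d)$. The parameter array of $\Phi$ is $(\{\theta_i\}_{i=0}^d;\{\theta^*_i\}_{i=0}^d;\{\varphi_i\}_{i=1}^d;\{\phi_i\}_{i=1}^d)$. It is known that each of the four sequences of vectors in the claim is a basis of $V$. *)

theory Defs
  imports "HOL-Computational_Algebra.Polynomial" "Jordan_Normal_Form.Matrix"
begin

definition tridiagonal_mat :: "'a::zero mat \<Rightarrow> bool" where
  "tridiagonal_mat Y \<longleftrightarrow> square_mat Y \<and>
     (\<forall>i<dim_row Y. \<forall>j<dim_col Y. Y $$ (i, j) \<noteq> 0 \<longrightarrow> i = j \<or> i = Suc j \<or> j = Suc i)"

definition irreducible_tridiagonal_mat :: "'a::zero mat \<Rightarrow> bool" where
  "irreducible_tridiagonal_mat Y \<longleftrightarrow> tridiagonal_mat Y \<and>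
     (\<forall>i. Suc i < dim_row Y \<longrightarrow> Y $$ (Suc i, i) \<noteq> 0 \<and> Y $$ (i, Suc i) \<noteq> 0)"

definition tau_poly :: "(nat \<Rightarrow> 'a::field) \<Rightarrow> nat \<Rightarrow> 'a poly" where
  "tau_poly \<theta> i = (\<Prod>h<i. [:- \<theta> h, 1:])"

definition eta_poly :: "nat \<Rightarrow> (nat \<Rightarrow> 'a::field) \<Rightarrow> nat \<Rightarrow> 'a poly" where
  "eta_poly d \<theta> i = (\<Prod>h<i. [:- \<theta> (d - h), 1:])"

text \<open>The vector space \<open>V\<close> is the whole type \<open>'b\<close>. Families indexed by \<open>0, \<dots>, d\<close>
  (or \<open>1, \<dots>, d\<close>) are functions on \<open>nat\<close>, whose values outside that range are irrelevant.\<close>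

definition endo ::
  "('a::field \<Rightarrow> 'b::ab_group_add \<Rightarrow> 'b) \<Rightarrow> ('b \<Rightarrow> 'b) set" where
  "endo scale = {X. Vector_Spaces.linear scale scale X}"

definition poly_endo ::
  "('a::field \<Rightarrow> 'b::ab_group_add \<Rightarrow> 'b) \<Rightarrow>
   'a poly \<Rightarrow> ('b \<Rightarrow> 'b) \<Rightarrow> 'b \<Rightarrow> 'b" where
  "poly_endo scale p X v = (\<Sum>k\<le>degree p. scale (coeff p k) ((X ^^ k) v))"

definition basis_family ::
  "('a::field \<Rightarrow> 'b::ab_group_add \<Rightarrow> 'b) \<Rightarrow>
   nat \<Rightarrow> (nat \<Rightarrow> 'b) \<Rightarrow> bool" where
  "basis_family scale d u \<longleftrightarrow>
     inj_on u {..d} \<and> \<not> module.dependent scale (u ` {..d}) \<and> module.span scale (u ` {..d}) = UNIV"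

definition represents ::
  "('a::field \<Rightarrow> 'b::ab_group_add \<Rightarrow> 'b) \<Rightarrow>
   nat \<Rightarrow> (nat \<Rightarrow> 'b) \<Rightarrow> 'a mat \<Rightarrow> ('b \<Rightarrow> 'b) \<Rightarrow> bool" where
  "represents scale d u Y X \<longleftrightarrow> basis_family scale d u \<and> Y \<in> carrier_mat (d + 1) (d + 1) \<and>
     (\<forall>j\<le>d. X (u j) = (\<Sum>i\<le>d. scale (Y $$ (i, j)) (u i)))"

definition leonard_pair ::
  "('a::field \<Rightarrow> 'b::ab_group_add \<Rightarrow> 'b) \<Rightarrow>
   ('b \<Rightarrow> 'b) \<Rightarrow> ('b \<Rightarrow> 'b) \<Rightarrow> bool" where
  "leonard_pair scale A As \<longleftrightarrow> A \<in> endo scale \<and> As \<in> endo scale \<and>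
     (\<exists>d u Y Z. represents scale d u Y A \<and> irreducible_tridiagonal_mat Y \<and>
                represents scale d u Z As \<and> diagonal_mat Z) \<and>
     (\<exists>d u Y Z. represents scale d u Y As \<and> irreducible_tridiagonal_mat Y \<and>
                represents scale d u Z A \<and> diagonal_mat Z)"

definition eigenspace ::
  "('a::field \<Rightarrow> 'b::ab_group_add \<Rightarrow> 'b) \<Rightarrow>
   ('b \<Rightarrow> 'b) \<Rightarrow> 'a \<Rightarrow> 'b set" where
  "eigenspace scale X \<theta> = {v. X v = scale \<theta> v}"

definition eigenvalue ::
  "('a::field \<Rightarrow> 'b::ab_group_add \<Rightarrow> 'b) \<Rightarrow>
   ('b \<Rightarrow> 'b) \<Rightarrow> 'a \<Rightarrow> bool" where
  "eigenvalue scale X \<theta> \<longleftrightarrow> eigenspace scale X \<theta> \<noteq> {0}"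

text \<open>These are the primitive idempotents when \<open>X\<close> is multiplicity-free, which is always the
  case for the two members of a Leonard pair.\<close>

definition primitive_idempotent_for ::
  "('a::field \<Rightarrow> 'b::ab_group_add \<Rightarrow> 'b) \<Rightarrow>
   ('b \<Rightarrow> 'b) \<Rightarrow> 'a \<Rightarrow> ('b \<Rightarrow> 'b) \<Rightarrow> bool" where
  "primitive_idempotent_for scale X \<theta> E \<longleftrightarrow> eigenvalue scale X \<theta> \<and> E \<in> endo scale \<and>
     (\<forall>v\<in>eigenspace scale X \<theta>. E v = v) \<and>
     (\<forall>\<theta>'. \<theta>' \<noteq> \<theta> \<longrightarrow> (\<forall>v\<in>eigenspace scale X \<theta>'. E v = 0))"

definition primitive_idempotent ::
  "('a::field \<Rightarrow> 'b::ab_group_add \<Rightarrow> 'b) \<Rightarrow>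
   ('b \<Rightarrow> 'b) \<Rightarrow> ('b \<Rightarrow> 'b) \<Rightarrow> bool" where
  "primitive_idempotent scale X E \<longleftrightarrow> (\<exists>\<theta>. primitive_idempotent_for scale X \<theta> E)"

definition standard_ordering ::
  "('a::field \<Rightarrow> 'b::ab_group_add \<Rightarrow> 'b) \<Rightarrow>
   nat \<Rightarrow> ('b \<Rightarrow> 'b) \<Rightarrow> ('b \<Rightarrow> 'b) \<Rightarrow> (nat \<Rightarrow> 'b \<Rightarrow> 'b) \<Rightarrow> bool" where
  "standard_ordering scale d A As E \<longleftrightarrow>
     bij_betw E {..d} {F. primitive_idempotent scale A F} \<and>
     (\<forall>w. (\<forall>i\<le>d. w i \<in> range (E i) \<and> w i \<noteq> 0) \<longrightarrow>
          (\<exists>Y. represents scale d w Y As \<and> irreducible_tridiagonal_mat Y))"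

definition leonard_system ::
  "('a::field \<Rightarrow> 'b::ab_group_add \<Rightarrow> 'b) \<Rightarrow>
   nat \<Rightarrow> ('b \<Rightarrow> 'b) \<Rightarrow> (nat \<Rightarrow> 'b \<Rightarrow> 'b) \<Rightarrow> ('b \<Rightarrow> 'b) \<Rightarrow> (nat \<Rightarrow> 'b \<Rightarrow> 'b) \<Rightarrow> bool" where
  "leonard_system scale d A E As Es \<longleftrightarrow>
     leonard_pair scale A As \<and> standard_ordering scale d A As E \<and> standard_ordering scale d As A Es"

definition endo_automorphism ::
  "('a::field \<Rightarrow> 'b::ab_group_add \<Rightarrow> 'b) \<Rightarrow>
   (('b \<Rightarrow> 'b) \<Rightarrow> ('b \<Rightarrow> 'b)) \<Rightarrow> bool" where
  "endo_automorphism scale \<sigma> \<longleftrightarrow> bij_betw \<sigma> (endo scale) (endo scale) \<and> \<sigma> id = id \<and>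
     (\<forall>X\<in>endo scale. \<forall>Y\<in>endo scale. \<sigma> (\<lambda>v. X v + Y v) = (\<lambda>v. \<sigma> X v + \<sigma> Y v)) \<and>
     (\<forall>c. \<forall>X\<in>endo scale. \<sigma> (\<lambda>v. scale c (X v)) = (\<lambda>v. scale c (\<sigma> X v))) \<and>
     (\<forall>X\<in>endo scale. \<forall>Y\<in>endo scale. \<sigma> (X \<circ> Y) = \<sigma> X \<circ> \<sigma> Y)"

definition self_dual ::
  "('a::field \<Rightarrow> 'b::ab_group_add \<Rightarrow> 'b) \<Rightarrow>
   nat \<Rightarrow> ('b \<Rightarrow> 'b) \<Rightarrow> (nat \<Rightarrow> 'b \<Rightarrow> 'b) \<Rightarrow> ('b \<Rightarrow> 'b) \<Rightarrow> (nat \<Rightarrow> 'b \<Rightarrow> 'b) \<Rightarrow> bool" where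
  "self_dual scale d A E As Es \<longleftrightarrow>
     (\<exists>\<sigma>. endo_automorphism scale \<sigma> \<and> \<sigma> A = As \<and> \<sigma> As = A \<and>
          (\<forall>i\<le>d. \<sigma> (E i) = Es i \<and> \<sigma> (Es i) = E i))"

text \<open>With \<open>p = \<tau>\<close> this describes the first split sequence, with \<open>p = \<eta>\<close> the second one.\<close>

definition split_sequence ::
  "('a::field \<Rightarrow> 'b::ab_group_add \<Rightarrow> 'b) \<Rightarrow>
   nat \<Rightarrow> ('b \<Rightarrow> 'b) \<Rightarrow> ('b \<Rightarrow> 'b) \<Rightarrow> (nat \<Rightarrow> 'b \<Rightarrow> 'b) \<Rightarrow> (nat \<Rightarrow> 'a poly) \<Rightarrow>
   (nat \<Rightarrow> 'a) \<Rightarrow> (nat \<Rightarrow> 'a) \<Rightarrow> bool" where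
  "split_sequence scale d A As Es p \<theta>s c \<longleftrightarrow>
     (\<forall>i\<in>{1..d}. c i \<noteq> 0) \<and>
     (\<forall>v\<in>range (Es 0). v \<noteq> 0 \<longrightarrow>
        As (poly_endo scale (p 0) A v) = scale (\<theta>s 0) (poly_endo scale (p 0) A v) \<and>
        (\<forall>i\<in>{1..d}. As (poly_endo scale (p i) A v) =
            scale (\<theta>s i) (poly_endo scale (p i) A v) + scale (c i) (poly_endo scale (p (i - 1)) A v)))"

definition parameter_array ::
  "('a::field \<Rightarrow> 'b::ab_group_add \<Rightarrow> 'b) \<Rightarrow>
   nat \<Rightarrow> ('b \<Rightarrow> 'b) \<Rightarrow> (nat \<Rightarrow> 'b \<Rightarrow> 'b) \<Rightarrow> ('b \<Rightarrow> 'b) \<Rightarrow> (nat \<Rightarrow> 'b \<Rightarrow> 'b) \<Rightarrow>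
   (nat \<Rightarrow> 'a) \<Rightarrow> (nat \<Rightarrow> 'a) \<Rightarrow> (nat \<Rightarrow> 'a) \<Rightarrow> (nat \<Rightarrow> 'a) \<Rightarrow> bool" where
  "parameter_array scale d A E As Es \<theta> \<theta>s \<phi>1 \<phi>2 \<longleftrightarrow>
     (\<forall>i\<le>d. primitive_idempotent_for scale A (\<theta> i) (E i)) \<and>
     (\<forall>i\<le>d. primitive_idempotent_for scale As (\<theta>s i) (Es i)) \<and>
     split_sequence scale d A As Es (tau_poly \<theta>) \<theta>s \<phi>1 \<and>
     split_sequence scale d A As Es (eta_poly d \<theta>) \<theta>s \<phi>2"

end

theory Submission
  imports Defs
begin

text \<open>Write \<open>x\<^sub>0, \<dots>, x\<^sub>d\<close> for eigenvectors of \<open>A\<^sup>*\<close>, and put \<open>u\<^sub>j = \<eta>\<^sub>j(A) x\<^sub>0\<close>, \<open>w\<^sub>j = \<tau>\<^sub>j(A) x\<^sub>d\<close> and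
  \<open>\<Phi>\<^sub>j = \<phi>\<^sub>1 \<cdots> \<phi>\<^sub>j\<close>, where \<open>\<phi>\<close> is the second split sequence. Let \<open>m\<close> be the scalar in front of the matrix.
  The claim for the two bases made from \<open>A\<close> is that \<open>T u\<^sub>j = m \<Phi>\<^sub>j u\<^sub>d\<^sub>-\<^sub>j\<close> and \<open>T w\<^sub>j = m \<Phi>\<^sub>j w\<^sub>d\<^sub>-\<^sub>j\<close>.

  There is a symmetric bilinear form, diagonal in the \<open>x\<^sub>i\<close>, for which \<open>A\<close> and \<open>A\<^sup>*\<close> are self-adjoint. A
  comparison of degrees shows that \<open>u\<close> and the reversal of \<open>w\<close> are dual to each other up to one
  nonzero factor (\<open>form_u_w\<close>). So both are bases, and the known action
  of \<open>A\<^sup>*\<close> on \<open>u\<close> gives its action on \<open>w\<close> (\<open>As_w\<close>): it lowers both chains. Descending them from \<open>u\<^sub>d\<close>, which lies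
  in \<open>E\<^sub>0V\<close>, and from \<open>w\<^sub>d\<close>, which lies in \<open>E\<^sub>dV\<close>, recovers the bases made from \<open>A\<^sup>*\<close>: these are the reversals of \<open>u\<close>
  and \<open>w\<close>, scaled by \<open>\<Phi>\<close>, once self-duality has been used to show that \<open>\<phi>\<^sub>i = \<phi>\<^sub>d\<^sub>-\<^sub>i\<^sub>+\<^sub>1\<close> (\<open>phi_symmetric\<close>).
  The matrix in the theorem is insensitive to this reversal and scaling.

  In \<open>T u\<^sub>j\<close> just one summand is nonzero, and it is found from
  \<open>E\<^sup>*\<^sub>0 E\<^sub>d x\<^sub>0 = m x\<^sub>0\<close> (\<open>T_u\<close>). On \<open>w\<close> the sum does not collapse in this way. Instead, the action on \<open>u\<close> shows that \<open>T A = A\<^sup>* T\<close>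
  and \<open>T A\<^sup>* = A T\<close>, so \<open>T w\<^sub>j = \<tau>\<^sub>j(A\<^sup>*) T x\<^sub>d\<close>, where \<open>T x\<^sub>d\<close> is a multiple of \<open>w\<^sub>d\<close>. The multiple is \<open>m\<close> because
  \<open>\<langle>x\<^sub>0, T x\<^sub>d\<rangle> = \<langle>T x\<^sub>0, x\<^sub>d\<rangle>\<close> (\<open>form_T_x0\<close>, \<open>T_x_last\<close>).\<close>


section \<open>Endomorphisms and their polynomials\<close>

definition coord ::
  "('a::field \<Rightarrow> 'b::ab_group_add \<Rightarrow> 'b) \<Rightarrow> nat \<Rightarrow> (nat \<Rightarrow> 'b) \<Rightarrow> nat \<Rightarrow> 'b \<Rightarrow> 'a" where
  "coord scale d b i v = module.representation scale (b ` {..d}) v (b i)"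

context vector_space
begin

lemma endoI:
  assumes "\<And>u v. X (u + v) = X u + X v" "\<And>c v. X (scale c v) = scale c (X v)"
  shows "X \<in> endo scale"
  unfolding endo_def using assms
  by (simp add: Vector_Spaces.linear_iff vector_space_axioms)

lemma endo_add: "X \<in> endo scale \<Longrightarrow> X (u + v) = X u + X v"
  by (simp add: endo_def Vector_Spaces.linear_iff)

lemma endo_scale: "X \<in> endo scale \<Longrightarrow> X (scale c v) = scale c (X v)"
  by (simp add: endo_def Vector_Spaces.linear_iff)

lemma endo_0: "X \<in> endo scale \<Longrightarrow> X 0 = 0"
  using endo_scale[of X 0 0] by simp

lemma endo_sum: "X \<in> endo scale \<Longrightarrow> X (\<Sum>i\<in>I. f i) = (\<Sum>i\<in>I. X (f i))"
  by (induction I rule: infinite_finite_induct) (simp_all add: endo_0 endo_add)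

lemma id_in_endo: "id \<in> endo scale"
  by (rule endoI) auto

lemma comp_in_endo: "X \<in> endo scale \<Longrightarrow> Z \<in> endo scale \<Longrightarrow> X \<circ> Z \<in> endo scale"
  by (rule endoI) (auto simp: endo_add endo_scale)

lemma scale_in_endo: "X \<in> endo scale \<Longrightarrow> (\<lambda>v. scale c (X v)) \<in> endo scale"
  by (rule endoI) (auto simp: endo_add endo_scale scale_right_distrib mult.commute)

lemma sum_in_endo:
  assumes "\<And>i. i \<in> I \<Longrightarrow> X i \<in> endo scale"
  shows "(\<lambda>v. \<Sum>i\<in>I. X i v) \<in> endo scale"
  by (rule endoI)
    (auto simp: endo_add[OF assms] endo_scale[OF assms] scale_sum_right sum.distrib cong: sum.cong)

lemma poly_endo_eq_sum:
  assumes "degree p \<le> n"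
  shows "poly_endo scale p X v = (\<Sum>k\<le>n. scale (coeff p k) ((X ^^ k) v))"
  unfolding poly_endo_def using assms
  by (intro sum.mono_neutral_left) (auto simp: coeff_eq_0)

lemma poly_endo_0 [simp]: "poly_endo scale 0 X v = 0"
  by (simp add: poly_endo_def)

lemma poly_endo_pCons:
  assumes "X \<in> endo scale"
  shows "poly_endo scale (pCons a p) X v = scale a v + X (poly_endo scale p X v)"
proof -
  have "poly_endo scale (pCons a p) X v
      = (\<Sum>k\<le>Suc (degree p). scale (coeff (pCons a p) k) ((X ^^ k) v))"
    by (rule poly_endo_eq_sum) (simp add: degree_pCons_le)
  also have "\<dots> = scale a v + (\<Sum>k\<le>degree p. scale (coeff p k) ((X ^^ Suc k) v))"
    by (subst sum.atMost_Suc_shift) simp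
  finally show ?thesis
    by (simp add: poly_endo_def endo_sum[OF assms] endo_scale[OF assms])
qed

lemma poly_endo_in_endo:
  assumes "X \<in> endo scale"
  shows "poly_endo scale p X \<in> endo scale"
proof (induction p)
  case 0
  show ?case by (rule endoI) auto
next
  case (pCons a p)
  then show ?case
    by (intro endoI)
      (auto simp: poly_endo_pCons assms endo_add endo_scale scale_right_distrib mult.commute)
qed

lemma poly_endo_commute:
  assumes "X \<in> endo scale"
  shows "poly_endo scale p X (X v) = X (poly_endo scale p X v)"
  by (induction p)
    (simp_all add: assms poly_endo_pCons endo_0 endo_add endo_scale)

lemma poly_endo_add:
  "poly_endo scale (p + q) X v = poly_endo scale p X v + poly_endo scale q X v"
proof -
  define n where "n = max (degree p) (degree q)"
  have "degree p \<le> n" "degree q \<le> n" "degree (p + q) \<le> n"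
    by (auto simp: n_def degree_add_le_max)
  then show ?thesis
    by (simp add: poly_endo_eq_sum[of _ n] scale_left_distrib sum.distrib)
qed

lemma poly_endo_smult:
  "poly_endo scale (Polynomial.smult c p) X v = scale c (poly_endo scale p X v)"
  using poly_endo_eq_sum[of "Polynomial.smult c p" "degree p" X v]
  by (simp add: poly_endo_def scale_sum_right degree_smult_le)

lemma poly_endo_mult:
  assumes "X \<in> endo scale"
  shows "poly_endo scale (p * q) X v = poly_endo scale p X (poly_endo scale q X v)"
  by (induction p)
    (simp_all add: poly_endo_pCons[OF assms] poly_endo_add poly_endo_smult)

lemma poly_endo_linear_factor:
  assumes "X \<in> endo scale"
  shows "poly_endo scale [:- a, 1:] X v = X v - scale a v"
  using assms by (simp add: poly_endo_pCons endo_0)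

text \<open>This is applied with \<open>L\<close> a primitive idempotent of \<open>X\<close> and \<open>t\<close> its eigenvalue.\<close>

lemma poly_endo_eval:
  assumes "X \<in> endo scale" "L \<in> endo scale" "\<And>v. L (X v) = scale t (L v)"
  shows "L (poly_endo scale p X v) = scale (poly p t) (L v)"
  by (induction p)
    (simp_all add: assms poly_endo_pCons endo_0[OF assms(2)] endo_add[OF assms(2)]
       endo_scale[OF assms(2)] scale_left_distrib)

lemma poly_endo_eigenvector:
  assumes "X \<in> endo scale" "X v = scale t v"
  shows "poly_endo scale p X v = scale (poly p t) v"
  by (induction p)
    (simp_all add: assms poly_endo_pCons endo_scale[OF assms(1)] scale_left_distrib mult.commute)

lemma poly_endo_intertwine:
  assumes "X \<in> endo scale" "Z \<in> endo scale" "S \<in> endo scale" "\<And>v. S (X v) = Z (S v)"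
  shows "S (poly_endo scale p X v) = poly_endo scale p Z (S v)"
  by (induction p)
    (simp_all add: assms poly_endo_pCons endo_0[OF assms(3)] endo_add[OF assms(3)]
       endo_scale[OF assms(3)])

text \<open>If \<open>X\<close> moves a chain of vectors down by at most one place per application, then \<open>k\<close> applications
  are needed to get from place \<open>k\<close> to the bottom. A map \<open>g\<close> that sees only the bottom of the chain
  therefore detects nothing but the coefficient of degree \<open>k\<close> of a polynomial of degree at most \<open>k\<close>.
  Since upward moves are allowed, this covers tridiagonal as well as triangular actions.\<close>

lemma poly_endo_lowering:
  assumes X: "X \<in> endo scale" and g: "g \<in> endo scale"
    and step: "\<And>k. k < d \<Longrightarrow> X (y (Suc k)) = (\<Sum>i\<le>d. scale (c i (Suc k)) (y i))"
    and hess: "\<And>i k. i < k \<Longrightarrow> k < d \<Longrightarrow> c i (Suc k) = 0"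
    and bottom: "\<And>k. 0 < k \<Longrightarrow> k \<le> d \<Longrightarrow> g (y k) = 0"
  shows "degree p \<le> k \<Longrightarrow> k \<le> d \<Longrightarrow>
    g (poly_endo scale p X (y k)) = scale (coeff p k * (\<Prod>h<k. c h (Suc h))) (g (y 0))"
proof (induction p arbitrary: k)
  case 0
  then show ?case by (simp add: endo_0[OF g])
next
  case (pCons a p)
  show ?case
  proof (cases k)
    case 0
    with pCons.prems have "p = 0" by (auto simp: degree_pCons_eq_if split: if_splits)
    with 0 show ?thesis
      by (simp add: poly_endo_pCons X endo_0[OF X] endo_scale[OF g])
  next
    case (Suc l)
    have l: "l < d" and deg: "degree p \<le> l"
      using pCons.prems Suc by (auto simp: degree_pCons_eq_if split: if_splits)
    have "g (poly_endo scale (pCons a p) X (y k))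
        = scale a (g (y k)) + g (poly_endo scale p X (X (y k)))"
      by (simp add: poly_endo_pCons X endo_add[OF g] endo_scale[OF g] poly_endo_commute)
    also have "\<dots> = g (poly_endo scale p X (X (y k)))"
      using bottom[of k] Suc pCons.prems by simp
    also have "\<dots> = (\<Sum>i\<le>d. scale (c i (Suc l)) (g (poly_endo scale p X (y i))))"
      by (simp add: Suc step l endo_sum[OF g] endo_scale[OF g]
          endo_sum[OF poly_endo_in_endo[OF X]] endo_scale[OF poly_endo_in_endo[OF X]])
    also have "\<dots> = (\<Sum>i\<le>d. if i = l then scale (c l (Suc l)) (g (poly_endo scale p X (y l))) else 0)"
    proof (rule sum.cong)
      fix i assume "i \<in> {..d}"
      then have i: "i \<le> d" by simp
      consider "i < l" | "i = l" | "l < i" by linarith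
      then show "scale (c i (Suc l)) (g (poly_endo scale p X (y i)))
          = (if i = l then scale (c l (Suc l)) (g (poly_endo scale p X (y l))) else 0)"
      proof cases
        case 1
        then show ?thesis using hess l by simp
      next
        case 3
        then show ?thesis using pCons.IH[of i] i deg by (simp add: coeff_eq_0)
      qed simp
    qed simp
    also have "\<dots> = scale (c l (Suc l)) (g (poly_endo scale p X (y l)))"
      using l by simp
    also have "\<dots> = scale (coeff (pCons a p) k * (\<Prod>h<k. c h (Suc h))) (g (y 0))"
      using pCons.IH[of l] deg l Suc by (simp add: mult.assoc mult.commute mult.left_commute)
    finally show ?thesis .
  qed
qed

text \<open>The factor \<open>X - b k\<close> kills the diagonal part of the action on \<open>y k\<close>, so applying these factors
  from the top downwards descends the chain one vector at a time.\<close>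

lemma poly_endo_ladder:
  assumes X: "X \<in> endo scale"
    and step: "\<And>k. k < d \<Longrightarrow> X (y (Suc k)) = scale (b (Suc k)) (y (Suc k)) + scale (f (Suc k)) (y k)"
    and "k \<le> d"
  shows "poly_endo scale (\<Prod>h<k. [:- b (d - h), 1:]) X (y d) = scale (\<Prod>h<k. f (d - h)) (y (d - k))"
  using \<open>k \<le> d\<close>
proof (induction k)
  case 0
  then show ?case by (simp add: one_pCons poly_endo_pCons X endo_0)
next
  case (Suc k)
  define l where "l = d - Suc k"
  have l: "d - k = Suc l" "l < d" using Suc.prems by (auto simp: l_def)
  have "poly_endo scale (\<Prod>h<Suc k. [:- b (d - h), 1:]) X (y d)
      = poly_endo scale [:- b (d - k), 1:] X (scale (\<Prod>h<k. f (d - h)) (y (d - k)))"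
    using Suc by (simp only: prod.lessThan_Suc poly_endo_mult[OF X] mult.commute)
  also have "\<dots> = scale (\<Prod>h<Suc k. f (d - h)) (y (d - Suc k))"
    by (simp add: poly_endo_linear_factor[OF X] endo_scale[OF X] l step l_def[symmetric]
        scale_right_distrib mult.commute)
  finally show ?case .
qed


section \<open>Bases indexed by an initial segment\<close>

lemma
  assumes "basis_family scale d b"
  shows coord_add: "coord scale d b i (u + v) = coord scale d b i u + coord scale d b i v"
    and coord_scale: "coord scale d b i (scale c v) = c * coord scale d b i v"
    and coord_basis: "\<lbrakk>i \<le> d; j \<le> d\<rbrakk> \<Longrightarrow> coord scale d b i (b j) = (if i = j then 1 else 0)"
    and sum_coord: "(\<Sum>i\<le>d. scale (coord scale d b i v) (b i)) = v"
proof -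
  have ind: "independent (b ` {..d})" and sp: "span (b ` {..d}) = UNIV" and inj: "inj_on b {..d}"
    using assms by (auto simp: basis_family_def)
  show "coord scale d b i (u + v) = coord scale d b i u + coord scale d b i v"
    by (simp add: coord_def representation_add[OF ind] sp)
  show "coord scale d b i (scale c v) = c * coord scale d b i v"
    by (simp add: coord_def representation_scale[OF ind] sp)
  show "coord scale d b i (b j) = (if i = j then 1 else 0)" if "i \<le> d" "j \<le> d"
    using that inj by (auto simp: coord_def representation_basis[OF ind] inj_on_def)
  have "(\<Sum>i\<le>d. scale (coord scale d b i v) (b i))
      = (\<Sum>z\<in>b ` {..d}. scale (representation (b ` {..d}) v z) z)"
    by (simp add: sum.reindex[OF inj] coord_def)
  also have "\<dots> = v"
    by (rule sum_representation_eq[OF ind]) (simp_all add: sp)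
  finally show "(\<Sum>i\<le>d. scale (coord scale d b i v) (b i)) = v" .
qed

lemma coord_sum:
  assumes "basis_family scale d b"
  shows "coord scale d b i (\<Sum>j\<in>J. f j) = (\<Sum>j\<in>J. coord scale d b i (f j))"
  using coord_scale[OF assms, of i 0 0]
  by (induction J rule: infinite_finite_induct) (simp_all add: coord_add[OF assms])

lemma endo_eq_on_basis:
  assumes b: "basis_family scale d b" and "X \<in> endo scale" "Z \<in> endo scale"
    and "\<And>j. j \<le> d \<Longrightarrow> X (b j) = Z (b j)"
  shows "X v = Z v"
proof -
  have "X (\<Sum>i\<le>d. scale (coord scale d b i v) (b i)) = Z (\<Sum>i\<le>d. scale (coord scale d b i v) (b i))"
    using assms by (simp add: endo_sum endo_scale)
  then show ?thesis by (simp add: sum_coord[OF b])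
qed

lemma basis_family_nonzero: "basis_family scale d b \<Longrightarrow> i \<le> d \<Longrightarrow> b i \<noteq> 0"
  using dependent_zero[of "b ` {..d}"] by (auto simp: basis_family_def)

end

text \<open>A dual family of functionals makes \<open>u\<close> injective and independent, and the given basis \<open>b\<close>
  says that its \<open>d + 1\<close> vectors are enough to span.\<close>

lemma (in finite_dimensional_vector_space) basis_family_of_biorthogonal:
  assumes b: "basis_family scale d b"
    and add: "\<And>i u v. f i (u + v) = f i u + f i v" and scl: "\<And>i c v. f i (scale c v) = c * f i v"
    and bi: "\<And>i j. \<lbrakk>i \<le> d; j \<le> d\<rbrakk> \<Longrightarrow> f i (u j) = (if i = j then m i else (0::'a))"
    and m: "\<And>i. i \<le> d \<Longrightarrow> m i \<noteq> 0"
  shows "basis_family scale d u"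
proof -
  have inj: "inj_on u {..d}"
  proof (rule inj_onI)
    fix i j assume "i \<in> {..d}" "j \<in> {..d}" "u i = u j"
    then show "i = j" using bi[of i i] bi[of i j] m by (auto split: if_splits)
  qed
  have f0: "f i 0 = 0" for i using scl[of i 0 0] by simp
  have fsum: "f i (\<Sum>j\<in>J. g j) = (\<Sum>j\<in>J. f i (g j))" for i and J :: "nat set" and g
    by (induction J rule: infinite_finite_induct) (simp_all add: f0 add)
  have ind: "independent (u ` {..d})"
  proof (rule independent_if_scalars_zero)
    fix q z assume q: "(\<Sum>z\<in>u ` {..d}. scale (q z) z) = 0" and "z \<in> u ` {..d}"
    then obtain i where i: "i \<le> d" "z = u i" by auto
    have "0 = f i (\<Sum>j\<le>d. scale (q (u j)) (u j))"
      using q by (simp add: sum.reindex[OF inj] f0)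
    also have "\<dots> = (\<Sum>j\<le>d. if j = i then q (u i) * m i else 0)"
      unfolding fsum by (rule sum.cong) (auto simp: scl bi i)
    also have "\<dots> = q (u i) * m i" using i by simp
    finally show "q z = 0" using m i by simp
  qed simp
  have "dim UNIV = card (b ` {..d})"
    using b by (intro dim_eq_card) (auto simp: basis_family_def)
  also have "\<dots> = card (u ` {..d})"
    using b inj by (simp add: card_image basis_family_def)
  finally have "UNIV \<subseteq> span (u ` {..d})"
    using ind by (intro card_ge_dim_independent) auto
  with inj ind show ?thesis by (auto simp: basis_family_def)
qed

lemma (in finite_dimensional_vector_space) represents_scale:
  assumes "represents scale d u Z X" "X \<in> endo scale" "c \<noteq> 0"
  shows "represents scale d (\<lambda>i. scale c (u i)) Z X"
proof -
  have b: "basis_family scale d u" using assms(1) by (simp add: represents_def)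
  have "basis_family scale d (\<lambda>i. scale c (u i))"
    by (rule basis_family_of_biorthogonal[OF b, where f = "coord scale d u" and m = "\<lambda>_. c"])
      (auto simp: coord_add[OF b] coord_scale[OF b] coord_basis[OF b] assms(3))
  moreover have "X (scale c (u j)) = (\<Sum>i\<le>d. scale (Z $$ (i, j)) (scale c (u i)))" if "j \<le> d" for j
    using assms that by (simp add: represents_def endo_scale scale_sum_right mult.commute)
  ultimately show ?thesis using assms(1) by (simp add: represents_def)
qed


section \<open>Shift polynomials and eigenbases\<close>

lemma poly_tau: "poly (tau_poly \<theta> i) t = (\<Prod>h<i. t - \<theta> h)"
  by (simp add: tau_poly_def poly_prod)

lemma poly_eta: "poly (eta_poly d \<theta> i) t = (\<Prod>h<i. t - \<theta> (d - h))"
  by (simp add: eta_poly_def poly_prod)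

lemma poly_tau_eq_0: "h < i \<Longrightarrow> poly (tau_poly \<theta> i) (\<theta> h) = 0"
  by (auto simp: poly_tau)

lemma poly_eta_eq_0: "\<lbrakk>h \<le> d; d < h + i\<rbrakk> \<Longrightarrow> poly (eta_poly d \<theta> i) (\<theta> h) = 0"
  by (auto simp: poly_eta intro!: bexI[of _ "d - h"])

lemma tau_poly_Suc: "tau_poly \<theta> (Suc i) = [:- \<theta> i, 1:] * tau_poly \<theta> i"
  by (simp add: tau_poly_def mult.commute)

lemma eta_poly_Suc: "eta_poly d \<theta> (Suc i) = [:- \<theta> (d - i), 1:] * eta_poly d \<theta> i"
  by (simp add: eta_poly_def mult.commute)

lemma degree_tau: "degree (tau_poly \<theta> i) = i" and lead_coeff_tau: "coeff (tau_poly \<theta> i) i = 1"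
proof -
  show deg: "degree (tau_poly \<theta> i) = i"
    by (simp add: tau_poly_def degree_prod_eq_sum_degree)
  have "lead_coeff (tau_poly \<theta> i) = 1"
    by (simp add: tau_poly_def lead_coeff_prod)
  with deg show "coeff (tau_poly \<theta> i) i = 1" by simp
qed

lemma eta_eq_tau: "eta_poly d \<theta> = tau_poly (\<lambda>h. \<theta> (d - h))"
  by (simp add: eta_poly_def tau_poly_def fun_eq_iff)

text \<open>The product is monic of degree \<open>i + j\<close>; its coefficient of degree \<open>d\<close> decides the pairing
  of the two split bases.\<close>

lemma coeff_eta_mult_tau:
  assumes "i + j \<le> d"
  shows "degree (eta_poly e \<theta> i * tau_poly \<theta>' j) \<le> d"
    and "coeff (eta_poly e \<theta> i * tau_poly \<theta>' j) d = (if i + j = d then 1 else 0)"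
proof -
  have deg: "degree (eta_poly e \<theta> i * tau_poly \<theta>' j) = i + j"
    using degree_mult_eq[of "eta_poly e \<theta> i" "tau_poly \<theta>' j"] lead_coeff_tau
    by (metis eta_eq_tau degree_tau coeff_0 zero_neq_one)
  then show "degree (eta_poly e \<theta> i * tau_poly \<theta>' j) \<le> d" using assms by simp
  show "coeff (eta_poly e \<theta> i * tau_poly \<theta>' j) d = (if i + j = d then 1 else 0)"
  proof (cases "i + j = d")
    case True
    then show ?thesis
      using coeff_mult_degree_sum[of "eta_poly e \<theta> i" "tau_poly \<theta>' j"]
      by (simp add: eta_eq_tau degree_tau lead_coeff_tau)
  next
    case False
    with assms deg show ?thesis by (simp add: coeff_eq_0)
  qed
qed

text \<open>A multiplicity-free map with its idempotents, together with a choice of eigenvectors. Both members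
  of a Leonard pair are instances, so that each fact about them is proved once.\<close>

locale eigen_system = vector_space scale
  for scale :: "'a::field \<Rightarrow> 'b::ab_group_add \<Rightarrow> 'b" +
  fixes d :: nat and X :: "'b \<Rightarrow> 'b" and \<theta> :: "nat \<Rightarrow> 'a" and E :: "nat \<Rightarrow> 'b \<Rightarrow> 'b" and b :: "nat \<Rightarrow> 'b"
  assumes X: "X \<in> endo scale" and E: "\<And>i. i \<le> d \<Longrightarrow> E i \<in> endo scale"
    and b: "basis_family scale d b" and inj: "inj_on \<theta> {..d}"
    and eig: "\<And>j. j \<le> d \<Longrightarrow> X (b j) = scale (\<theta> j) (b j)"
    and E_b: "\<And>i j. \<lbrakk>i \<le> d; j \<le> d\<rbrakk> \<Longrightarrow> E i (b j) = (if i = j then b j else 0)"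
begin

lemma E_eq_coord:
  assumes "i \<le> d"
  shows "E i v = scale (coord scale d b i v) (b i)"
proof -
  have "E i v = E i (\<Sum>j\<le>d. scale (coord scale d b j v) (b j))" by (simp add: sum_coord[OF b])
  also have "\<dots> = (\<Sum>j\<le>d. if j = i then scale (coord scale d b i v) (b i) else 0)"
    unfolding endo_sum[OF E[OF assms]]
    by (rule sum.cong) (auto simp: endo_scale[OF E[OF assms]] E_b assms)
  also have "\<dots> = scale (coord scale d b i v) (b i)" using assms by simp
  finally show ?thesis .
qed

lemma sum_E: "(\<Sum>i\<le>d. E i v) = v"
  using sum_coord[OF b] by (simp add: E_eq_coord)

lemma X_E: "i \<le> d \<Longrightarrow> X (E i v) = scale (\<theta> i) (E i v)"
  by (simp add: E_eq_coord endo_scale[OF X] eig mult.commute)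

lemma E_X:
  assumes "i \<le> d"
  shows "E i (X v) = scale (\<theta> i) (E i v)"
  using endo_eq_on_basis[OF b comp_in_endo[OF E[OF assms] X] scale_in_endo[OF E[OF assms]]] assms
  by (simp add: eig E_b endo_scale[OF E[OF assms]])

lemma E_poly: "i \<le> d \<Longrightarrow> E i (poly_endo scale p X v) = scale (poly p (\<theta> i)) (E i v)"
  by (rule poly_endo_eval[OF X E E_X])

text \<open>A polynomial in \<open>X\<close> acts on the \<open>j\<close>-th eigenspace by its value at \<open>\<theta> j\<close>, hence a polynomial
  vanishing at the other eigenvalues is a multiple of the \<open>i\<close>-th idempotent.\<close>

lemma poly_endo_eq_idempotent:
  assumes "i \<le> d" "\<And>j. \<lbrakk>j \<le> d; j \<noteq> i\<rbrakk> \<Longrightarrow> poly p (\<theta> j) = 0"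
  shows "poly_endo scale p X v = scale (poly p (\<theta> i)) (E i v)"
proof -
  have "poly_endo scale p X v = (\<Sum>j\<le>d. E j (poly_endo scale p X v))" by (simp add: sum_E)
  also have "\<dots> = (\<Sum>j\<le>d. if j = i then scale (poly p (\<theta> i)) (E i v) else 0)"
    by (rule sum.cong) (auto simp: E_poly assms)
  finally show ?thesis using assms by simp
qed

lemma poly_endo_eq_0:
  assumes "\<And>j. j \<le> d \<Longrightarrow> poly p (\<theta> j) = 0"
  shows "poly_endo scale p X v = 0"
  using poly_endo_eq_idempotent[of 0 p v] assms by simp

lemma eigenvector_eq_E:
  assumes "i \<le> d" "X v = scale (\<theta> i) v"
  shows "E i v = v"
proof -
  have "E j v = 0" if "j \<le> d" "j \<noteq> i" for j
  proof -
    have "scale (\<theta> j - \<theta> i) (E j v) = 0"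
      using E_X[OF that(1), of v] assms(2) by (auto simp: scale_left_diff_distrib endo_scale[OF E[OF that(1)]])
    moreover have "\<theta> j \<noteq> \<theta> i" using inj that assms(1) by (auto simp: inj_on_def)
    ultimately show ?thesis by simp
  qed
  then have "(\<Sum>j\<le>d. E j v) = (\<Sum>j\<le>d. if j = i then E i v else 0)"
    by (intro sum.cong) auto
  with assms(1) show ?thesis by (simp add: sum_E)
qed

lemma range_E_multiple:
  assumes "i \<le> d" "v \<in> range (E i)" "v \<noteq> 0" "z \<in> range (E i)" "z \<noteq> 0"
  obtains c where "c \<noteq> 0" "z = scale c v"
proof -
  obtain p where p: "v = scale p (b i)" using assms by (auto simp: E_eq_coord)
  obtain q where q: "z = scale q (b i)" using assms by (auto simp: E_eq_coord)
  have "p \<noteq> 0" "q \<noteq> 0" using p q assms by auto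
  then show ?thesis using p q by (intro that[of "q / p"]) auto
qed

lemma poly_tau_last_nonzero: "poly (tau_poly \<theta> d) (\<theta> d) \<noteq> 0"
  by (auto simp: poly_tau dest: inj_onD[OF inj])

lemma poly_eta_first_nonzero: "poly (eta_poly d \<theta> d) (\<theta> 0) \<noteq> 0"
  by (auto simp: poly_eta dest: inj_onD[OF inj])

end


text \<open>An idempotent is prescribed only on the eigenspaces of \<open>X\<close>, which determines it because the
  eigenvectors of the diagonalizable \<open>X\<close> span. It follows that equal eigenvalues would give equal
  idempotents, so the eigenvalues along a standard ordering are distinct.\<close>

lemma (in vector_space) standard_ordering_eigenbasis:
  assumes X: "X \<in> endo scale" and rep: "represents scale e z D X" and diag: "diagonal_mat D"
    and prim: "\<And>i. i \<le> d \<Longrightarrow> primitive_idempotent_for scale X (\<theta> i) (E i)"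
    and std: "standard_ordering scale d X Xs E"
  obtains b Z where "eigen_system scale d X \<theta> E b" "represents scale d b Z Xs" "irreducible_tridiagonal_mat Z"
proof -
  have z: "basis_family scale e z" using rep by (simp add: represents_def)
  have E: "E i \<in> endo scale" if "i \<le> d" for i using prim[OF that] by (simp add: primitive_idempotent_for_def)
  have Xz: "X (z k) = scale (D $$ (k, k)) (z k)" if "k \<le> e" for k
  proof -
    have "X (z k) = (\<Sum>i\<le>e. scale (D $$ (i, k)) (z i))" using rep that by (simp add: represents_def)
    also have "\<dots> = (\<Sum>i\<le>e. if i = k then scale (D $$ (k, k)) (z k) else 0)"
      by (rule sum.cong) (use rep diag that in \<open>auto simp: represents_def diagonal_mat_def\<close>)
    finally show ?thesis using that by simp
  qed
  have Ez: "E i (z k) = (if D $$ (k, k) = \<theta> i then z k else 0)" if "i \<le> d" "k \<le> e" for i k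
    using prim[OF that(1)] Xz[OF that(2)] by (auto simp: primitive_idempotent_for_def eigenspace_def)
  have inj: "inj_on \<theta> {..d}"
  proof (rule inj_onI)
    fix i j assume ij: "i \<in> {..d}" "j \<in> {..d}" "\<theta> i = \<theta> j"
    have "E i v = E j v" for v
      by (rule endo_eq_on_basis[OF z]) (use ij E Ez in auto)
    then have "E i = E j" by auto
    then show "i = j" using std ij by (auto simp: standard_ordering_def bij_betw_def inj_on_def)
  qed
  have "\<exists>v. v \<noteq> 0 \<and> X v = scale (\<theta> i) v" if "i \<le> d" for i
    using prim[OF that] endo_0[OF X] by (auto simp: primitive_idempotent_for_def eigenvalue_def eigenspace_def)
  then obtain b where b: "\<And>i. i \<le> d \<Longrightarrow> b i \<noteq> 0 \<and> X (b i) = scale (\<theta> i) (b i)" by metis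
  have E_b: "E i (b j) = (if i = j then b j else 0)" if "i \<le> d" "j \<le> d" for i j
  proof (cases "i = j")
    case True
    then show ?thesis
      using prim[OF that(1)] b[OF that(2)] by (simp add: primitive_idempotent_for_def eigenspace_def)
  next
    case False
    then have "\<theta> j \<noteq> \<theta> i" using inj that by (auto simp: inj_on_def)
    then show ?thesis
      using prim[OF that(1)] b[OF that(2)] False
      by (auto simp: primitive_idempotent_for_def eigenspace_def)
  qed
  then have "\<forall>i\<le>d. b i \<in> range (E i) \<and> b i \<noteq> 0" using b by (metis rangeI)
  then obtain Z where Z: "represents scale d b Z Xs" "irreducible_tridiagonal_mat Z"
    using std unfolding standard_ordering_def by blast
  have "eigen_system scale d X \<theta> E b"
    by unfold_locales (use X E Z inj b E_b in \<open>auto simp: represents_def\<close>)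
  with Z that show thesis by blast
qed


section \<open>The two split bases and the bilinear form pairing them\<close>

text \<open>A Leonard system seen through an eigenbasis \<open>x\<close> of \<open>As\<close>, on which \<open>A\<close> acts by the irreducible
  tridiagonal matrix \<open>Y\<close>. The equations for the split sequences are stated for \<open>x 0\<close>, which spans
  the range of \<open>Es 0\<close>.\<close>

locale leonard_array = finite_dimensional_vector_space scale Basis
  + A: eigen_system scale d A \<theta> E b + As: eigen_system scale d As \<theta>s Es x
  for scale :: "'a::field \<Rightarrow> 'b::ab_group_add \<Rightarrow> 'b" and Basis d A \<theta> E b As \<theta>s Es x +
  fixes Y :: "'a mat" and \<phi>1 \<phi>2 :: "nat \<Rightarrow> 'a"
  assumes A_x: "\<And>j. j \<le> d \<Longrightarrow> A (x j) = (\<Sum>i\<le>d. scale (Y $$ (i, j)) (x i))"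
    and tridiag: "\<And>i j. \<lbrakk>i \<le> d; j \<le> d; Y $$ (i, j) \<noteq> 0\<rbrakk> \<Longrightarrow> i = j \<or> i = Suc j \<or> j = Suc i"
    and irred: "\<And>i. i < d \<Longrightarrow> Y $$ (Suc i, i) \<noteq> 0 \<and> Y $$ (i, Suc i) \<noteq> 0"
    and first_split: "\<And>i. i < d \<Longrightarrow> As (poly_endo scale (tau_poly \<theta> (Suc i)) A (x 0)) =
      scale (\<theta>s (Suc i)) (poly_endo scale (tau_poly \<theta> (Suc i)) A (x 0)) +
      scale (\<phi>1 (Suc i)) (poly_endo scale (tau_poly \<theta> i) A (x 0))"
    and second_split: "\<And>i. i < d \<Longrightarrow> As (poly_endo scale (eta_poly d \<theta> (Suc i)) A (x 0)) =
      scale (\<theta>s (Suc i)) (poly_endo scale (eta_poly d \<theta> (Suc i)) A (x 0)) +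
      scale (\<phi>2 (Suc i)) (poly_endo scale (eta_poly d \<theta> i) A (x 0))"
    and phi_nonzero: "\<And>i. i < d \<Longrightarrow> \<phi>2 (Suc i) \<noteq> 0"
begin

text \<open>\<open>A\<close> raises and \<open>As\<close> lowers both chains: \<open>u\<close> starts from the first and \<open>w\<close> from the last eigenvector
  of \<open>As\<close>.\<close>

definition u :: "nat \<Rightarrow> 'b" where "u j = poly_endo scale (eta_poly d \<theta> j) A (x 0)"

definition w :: "nat \<Rightarrow> 'b" where "w j = poly_endo scale (tau_poly \<theta> j) A (x d)"

lemma u_0: "u 0 = x 0" and w_0: "w 0 = x d"
  by (simp_all add: u_def w_def eta_poly_def tau_poly_def one_pCons poly_endo_pCons A.X endo_0[OF A.X])

lemma A_u: "A (u j) = scale (\<theta> (d - j)) (u j) + u (Suc j)"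
  unfolding u_def eta_poly_Suc poly_endo_mult[OF A.X] poly_endo_linear_factor[OF A.X] by simp

lemma A_w: "A (w j) = scale (\<theta> j) (w j) + w (Suc j)"
  unfolding w_def tau_poly_Suc poly_endo_mult[OF A.X] poly_endo_linear_factor[OF A.X] by simp

lemma u_top: "u (Suc d) = 0"
  unfolding u_def by (rule A.poly_endo_eq_0) (simp add: poly_eta_eq_0)

lemma w_top: "w (Suc d) = 0"
  unfolding w_def by (rule A.poly_endo_eq_0) (simp add: poly_tau_eq_0)

lemma As_u_0: "As (u 0) = scale (\<theta>s 0) (u 0)"
  by (simp add: u_0 As.eig)

lemma As_u: "i < d \<Longrightarrow> As (u (Suc i)) = scale (\<theta>s (Suc i)) (u (Suc i)) + scale (\<phi>2 (Suc i)) (u i)"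
  unfolding u_def by (rule second_split)

text \<open>The weights are those that turn the tridiagonal matrix of \<open>A\<close> into a symmetric one, so the
  form below, diagonal in an eigenbasis of \<open>As\<close>, makes \<open>A\<close> and \<open>As\<close> both self-adjoint. It takes
  the place of the antiautomorphism of the endomorphism algebra that fixes \<open>A\<close> and \<open>As\<close>.\<close>

definition weight :: "nat \<Rightarrow> 'a" where
  "weight i = (\<Prod>h<i. Y $$ (h, Suc h) / Y $$ (Suc h, h))"

definition form :: "'b \<Rightarrow> 'b \<Rightarrow> 'a" where
  "form y z = (\<Sum>i\<le>d. weight i * coord scale d x i y * coord scale d x i z)"

lemma form_add_left: "form (y + y') z = form y z + form y' z"
  and form_add_right: "form y (z + z') = form y z + form y z'"
  and form_scale_left: "form (scale c y) z = c * form y z"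
  and form_scale_right: "form y (scale c z) = c * form y z"
  by (simp_all add: form_def coord_add[OF As.b] coord_scale[OF As.b] algebra_simps
      sum.distrib sum_distrib_left)

lemma form_0_left: "form 0 z = 0" and form_0_right: "form y 0 = 0"
  using form_scale_left[of 0 0 z] form_scale_right[of y 0 0] by simp_all

lemma form_x_left: "i \<le> d \<Longrightarrow> form (x i) z = weight i * coord scale d x i z"
proof -
  assume i: "i \<le> d"
  have "form (x i) z = (\<Sum>j\<le>d. if j = i then weight i * coord scale d x i z else 0)"
    unfolding form_def by (rule sum.cong) (auto simp: coord_basis[OF As.b] i)
  with i show ?thesis by simp
qed

lemma weight_nonzero: "i \<le> d \<Longrightarrow> weight i \<noteq> 0"
  using irred by (auto simp: weight_def)

lemma weight_symmetrizes:
  assumes "i \<le> d" "j \<le> d"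
  shows "weight i * Y $$ (i, j) = weight j * Y $$ (j, i)"
proof -
  have step: "weight i * Y $$ (i, Suc i) = weight (Suc i) * Y $$ (Suc i, i)" if "i < d" for i
    using irred[OF that] by (simp add: weight_def)
  show ?thesis
  proof (cases "Y $$ (i, j) = 0 \<and> Y $$ (j, i) = 0")
    case False
    then consider "i = j" | "i = Suc j" | "j = Suc i" using tridiag assms by blast
    then show ?thesis using step assms by cases auto
  qed simp
qed

lemma coord_A:
  assumes i: "i \<le> d"
  shows "coord scale d x i (A y) = (\<Sum>j\<le>d. Y $$ (i, j) * coord scale d x j y)"
proof -
  have row: "(\<Sum>k\<le>d. Y $$ (k, j) * coord scale d x i (x k)) = Y $$ (i, j)" for j
  proof -
    have "(\<Sum>k\<le>d. Y $$ (k, j) * coord scale d x i (x k)) = (\<Sum>k\<le>d. if k = i then Y $$ (i, j) else 0)"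
      by (rule sum.cong) (auto simp: coord_basis[OF As.b] i)
    with i show ?thesis by simp
  qed
  have "A y = (\<Sum>j\<le>d. scale (coord scale d x j y) (A (x j)))"
    using sum_coord[OF As.b, of y] endo_sum[OF A.X] endo_scale[OF A.X]
    by (metis (no_types, lifting) sum.cong)
  then show ?thesis using i
    by (simp add: A_x coord_sum[OF As.b] coord_scale[OF As.b] row mult.commute)
qed

lemma form_A: "form (A y) z = form y (A z)"
proof -
  have "form (A y) z = (\<Sum>i\<le>d. \<Sum>j\<le>d. (weight i * Y $$ (i, j)) * coord scale d x j y * coord scale d x i z)"
    by (simp add: form_def coord_A sum_distrib_left sum_distrib_right mult.assoc)
  also have "\<dots> = (\<Sum>i\<le>d. \<Sum>j\<le>d. (weight j * Y $$ (j, i)) * coord scale d x j y * coord scale d x i z)"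
    by (intro sum.cong refl) (simp add: weight_symmetrizes)
  also have "\<dots> = (\<Sum>j\<le>d. \<Sum>i\<le>d. (weight j * Y $$ (j, i)) * coord scale d x j y * coord scale d x i z)"
    by (rule sum.swap)
  also have "\<dots> = form y (A z)"
    by (simp add: form_def coord_A sum_distrib_left ac_simps)
  finally show ?thesis .
qed

lemma form_poly_A: "form (poly_endo scale p A y) z = form y (poly_endo scale p A z)"
  by (induction p arbitrary: z)
    (simp_all add: poly_endo_pCons A.X form_0_left form_0_right form_add_left form_add_right
      form_scale_left form_scale_right form_A poly_endo_commute)

lemma form_As: "form (As y) z = form y (As z)"
proof -
  have "coord scale d x i (As y) = \<theta>s i * coord scale d x i y" if "i \<le> d" for i y
  proof -
    have "coord scale d x i (Es i (As y)) = coord scale d x i (scale (\<theta>s i) (Es i y))"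
      by (simp only: As.E_X[OF that])
    then show ?thesis
      by (simp add: As.E_eq_coord[OF that] coord_scale[OF As.b] coord_basis[OF As.b] that)
  qed
  then show ?thesis by (simp add: form_def ac_simps)
qed

lemma form_nondegenerate:
  assumes y: "basis_family scale d y" and eq: "\<And>i. i \<le> d \<Longrightarrow> form (y i) z = form (y i) z'"
  shows "z = z'"
proof -
  have form_sum: "form (\<Sum>j\<in>J. f j) z = (\<Sum>j\<in>J. form (f j) z)" for J :: "nat set" and f z
    by (induction J rule: infinite_finite_induct) (simp_all add: form_0_left form_add_left)
  have "form (\<Sum>j\<le>d. scale (coord scale d y j v) (y j)) z = form (\<Sum>j\<le>d. scale (coord scale d y j v) (y j)) z'"
    for v by (simp add: form_sum form_scale_left eq)
  then have "form v z = form v z'" for v by (simp add: sum_coord[OF y])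
  then have "coord scale d x i z = coord scale d x i z'" if "i \<le> d" for i
    using that weight_nonzero[OF that] by (metis form_x_left mult_left_cancel)
  then have "(\<Sum>i\<le>d. scale (coord scale d x i z) (x i)) = (\<Sum>i\<le>d. scale (coord scale d x i z') (x i))" by simp
  then show ?thesis by (simp add: sum_coord[OF As.b])
qed

definition pairing :: 'a where "pairing = (\<Prod>h<d. Y $$ (h, Suc h))"

lemma pairing_nonzero: "pairing \<noteq> 0"
  using irred by (simp add: pairing_def)

text \<open>Moving the polynomial in \<open>A\<close> to the right-hand side leaves \<open>x 0\<close> paired with
  \<open>\<eta>\<^sub>i(A) \<tau>\<^sub>j(A) x\<^sub>d\<close>. For \<open>i + j < d\<close> the degree is too small for the tridiagonal \<open>A\<close> to get from \<open>x d\<close>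
  to \<open>x 0\<close>; for \<open>i + j > d\<close> the polynomial vanishes at every eigenvalue; for \<open>i + j = d\<close>
  only the leading coefficient \<open>1\<close> counts.\<close>

lemma form_u_w:
  assumes "i \<le> d" "j \<le> d"
  shows "form (u i) (w j) = (if i + j = d then pairing else 0)"
proof -
  let ?p = "eta_poly d \<theta> i * tau_poly \<theta> j"
  have eq: "form (u i) (w j) = coord scale d x 0 (poly_endo scale ?p A (x d))"
    by (simp add: u_def w_def form_poly_A poly_endo_mult[OF A.X] form_x_left weight_def)
  show ?thesis
  proof (cases "i + j \<le> d")
    case True
    have "Es 0 (poly_endo scale ?p A (x d)) = scale (coeff ?p d * pairing) (Es 0 (x 0))"
      unfolding pairing_def
    proof (rule poly_endo_lowering[where d = d and c = "\<lambda>i j. Y $$ (i, j)"])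
      show "Y $$ (i, Suc k) = 0" if "i < k" "k < d" for i k
        using tridiag[of i "Suc k"] that by fastforce
    qed (use A.X As.E A_x As.E_b coeff_eta_mult_tau[OF True] in auto)
    then have "coord scale d x 0 (Es 0 (poly_endo scale ?p A (x d))) = coeff ?p d * pairing"
      by (simp add: As.E_b coord_scale[OF As.b] coord_basis[OF As.b])
    then show ?thesis
      using coeff_eta_mult_tau[OF True, of d \<theta> \<theta>] eq
      by (simp add: As.E_eq_coord coord_scale[OF As.b] coord_basis[OF As.b])
  next
    case False
    have "poly ?p (\<theta> h) = 0" if "h \<le> d" for h
      using that False poly_tau_eq_0[of h j \<theta>] poly_eta_eq_0[of h d i \<theta>] by (cases "h < j") auto
    then have "poly_endo scale ?p A (x d) = 0" by (rule A.poly_endo_eq_0)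
    then show ?thesis using eq False form_x_left[of 0 0] by (simp add: weight_def form_0_right)
  qed
qed

lemma basis_u: "basis_family scale d u"
  by (rule basis_family_of_biorthogonal[OF As.b, where f = "\<lambda>i y. form y (w (d - i))" and m = "\<lambda>_. pairing"])
    (auto simp: form_add_left form_scale_left form_u_w pairing_nonzero)

lemma basis_w: "basis_family scale d w"
  by (rule basis_family_of_biorthogonal[OF As.b, where f = "\<lambda>i y. form (u (d - i)) y" and m = "\<lambda>_. pairing"])
    (auto simp: form_add_right form_scale_right form_u_w pairing_nonzero)

text \<open>Up to the factor \<open>pairing\<close>, the reversal of \<open>w\<close> is the basis dual to \<open>u\<close>, so the self-adjoint \<open>As\<close>
  acts on it by the transpose of its matrix on \<open>u\<close>. This is where the second split sequence
  reappears, reversed, for the chain that starts at the other end.\<close>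

lemma As_w:
  assumes "j < d"
  shows "As (w (Suc j)) = scale (\<theta>s (d - Suc j)) (w (Suc j)) + scale (\<phi>2 (d - j)) (w j)"
proof (rule form_nondegenerate[OF basis_u])
  fix i assume i: "i \<le> d"
  show "form (u i) (As (w (Suc j)))
      = form (u i) (scale (\<theta>s (d - Suc j)) (w (Suc j)) + scale (\<phi>2 (d - j)) (w j))"
  proof (cases i)
    case 0
    then show ?thesis using assms
      by (simp add: form_As[symmetric] As_u_0 form_scale_left form_add_right form_scale_right form_u_w)
  next
    case (Suc l)
    then show ?thesis using assms i
      by (simp add: form_As[symmetric] As_u form_add_left form_scale_left form_add_right
          form_scale_right form_u_w) (auto simp: form_u_w)
  qed
qed

lemma ladder_u:
  "k \<le> d \<Longrightarrow> poly_endo scale (eta_poly d \<theta>s k) As (u d) = scale (\<Prod>h<k. \<phi>2 (d - h)) (u (d - k))"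
  unfolding eta_poly_def by (rule poly_endo_ladder[OF As.X, where b = \<theta>s and f = \<phi>2 and y = u, OF As_u])

lemma ladder_w:
  assumes "k \<le> d"
  shows "poly_endo scale (tau_poly \<theta>s k) As (w d) = scale (\<Prod>h<k. \<phi>2 (Suc h)) (w (d - k))"
proof -
  have "poly_endo scale (\<Prod>h<k. [:- \<theta>s (d - (d - h)), 1:]) As (w d)
      = scale (\<Prod>h<k. \<phi>2 (Suc d - (d - h))) (w (d - k))"
    by (rule poly_endo_ladder[OF As.X, where b = "\<lambda>k. \<theta>s (d - k)" and f = "\<lambda>k. \<phi>2 (Suc d - k)"])
      (use As_w assms in auto)
  moreover have "d - (d - h) = h \<and> Suc d - (d - h) = Suc h" if "h < k" for h
    using that assms by auto
  ultimately show ?thesis by (simp add: tau_poly_def)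
qed

text \<open>The last vectors of the two chains lie in the two extreme eigenspaces of \<open>A\<close>. They serve as
  the starting vectors for the two bases made from polynomials in \<open>As\<close>.\<close>

lemma E_u_last: "E 0 (u d) = u d"
  using A_u[of d] u_top by (intro A.eigenvector_eq_E) auto

lemma E_w_last: "E d (w d) = w d"
  using A_w[of d] w_top by (intro A.eigenvector_eq_E) auto

end


section \<open>Self-duality\<close>

locale self_dual_leonard_array = leonard_array scale Basis d A \<theta> E b As \<theta>s Es x Y \<phi>1 \<phi>2
  for scale :: "'a::field \<Rightarrow> 'b::ab_group_add \<Rightarrow> 'b" and Basis d A \<theta> E b As \<theta>s Es x Y \<phi>1 \<phi>2 +
  assumes duality: "self_dual scale d A E As Es"
begin

text \<open>The automorphism turns every polynomial in \<open>A\<close> into the same polynomial in \<open>As\<close>. Applied to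
  \<open>A\<^sup>* E\<^sup>*\<^sub>i = \<theta>\<^sup>*\<^sub>i E\<^sup>*\<^sub>i\<close> it gives the equality of the eigenvalue sequences, and applied to the second split
  relation, written as an identity of maps by multiplying with \<open>Es 0\<close>, it gives the same
  relation for the dual chain in the range of \<open>E 0\<close>, represented by \<open>u d\<close>.\<close>

lemma
  shows dual_eigenvalues_eq: "i \<le> d \<Longrightarrow> \<theta>s i = \<theta> i"
    and second_split_dual: "i < d \<Longrightarrow>
      A (poly_endo scale (eta_poly d \<theta> (Suc i)) As (u d)) =
      scale (\<theta>s (Suc i)) (poly_endo scale (eta_poly d \<theta> (Suc i)) As (u d)) +
      scale (\<phi>2 (Suc i)) (poly_endo scale (eta_poly d \<theta> i) As (u d))"
proof -
  obtain \<sigma> where \<sigma>: "endo_automorphism scale \<sigma>" and A_As: "\<sigma> A = As" "\<sigma> As = A"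
    and E_Es: "\<And>i. i \<le> d \<Longrightarrow> \<sigma> (E i) = Es i" "\<And>i. i \<le> d \<Longrightarrow> \<sigma> (Es i) = E i"
    using duality unfolding self_dual_def by blast
  have \<sigma>_add: "\<sigma> (\<lambda>v. S v + R v) = (\<lambda>v. \<sigma> S v + \<sigma> R v)"
    and \<sigma>_comp: "\<sigma> (S \<circ> R) = \<sigma> S \<circ> \<sigma> R" if "S \<in> endo scale" "R \<in> endo scale" for S R
    using \<sigma> that unfolding endo_automorphism_def by blast+
  have \<sigma>_scale: "\<sigma> (\<lambda>v. scale c (S v)) = (\<lambda>v. scale c (\<sigma> S v))" if "S \<in> endo scale" for c S
    using \<sigma> that unfolding endo_automorphism_def by blast
  have \<sigma>_id: "\<sigma> id = id" using \<sigma> unfolding endo_automorphism_def by blast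
  have \<sigma>_poly: "\<sigma> (poly_endo scale p A) = poly_endo scale p As" for p
  proof (induction p)
    case 0
    have "poly_endo scale 0 A = (\<lambda>v. scale 0 (id v))" by auto
    then show ?case using \<sigma>_scale[OF id_in_endo, of 0] by auto
  next
    case (pCons a p)
    have "poly_endo scale (pCons a p) A = (\<lambda>v. scale a (id v) + (A \<circ> poly_endo scale p A) v)"
      by (auto simp: poly_endo_pCons A.X)
    then have "\<sigma> (poly_endo scale (pCons a p) A)
        = (\<lambda>v. \<sigma> (\<lambda>v. scale a (id v)) v + \<sigma> (A \<circ> poly_endo scale p A) v)"
      by (simp only: \<sigma>_add scale_in_endo id_in_endo comp_in_endo A.X poly_endo_in_endo)
    also have "\<dots> = poly_endo scale (pCons a p) As"
      using \<sigma>_scale[OF id_in_endo, of a]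
      by (auto simp: \<sigma>_comp A.X poly_endo_in_endo pCons.IH A_As \<sigma>_id poly_endo_pCons As.X)
    finally show ?case .
  qed
  show "\<theta>s i = \<theta> i" if i: "i \<le> d" for i
  proof -
    have "As \<circ> Es i = (\<lambda>v. scale (\<theta>s i) (Es i v))" by (auto simp: As.X_E[OF i])
    then have "\<sigma> As \<circ> \<sigma> (Es i) = (\<lambda>v. scale (\<theta>s i) (\<sigma> (Es i) v))"
      using \<sigma>_comp[OF As.X As.E[OF i]] \<sigma>_scale[OF As.E[OF i], of "\<theta>s i"] by simp
    then have "A (E i (b i)) = scale (\<theta>s i) (E i (b i))"
      by (simp add: A_As E_Es i fun_eq_iff)
    then show ?thesis
      using basis_family_nonzero[OF A.b i] by (simp add: A.E_b i A.eig)
  qed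
  show "A (poly_endo scale (eta_poly d \<theta> (Suc i)) As (u d)) =
      scale (\<theta>s (Suc i)) (poly_endo scale (eta_poly d \<theta> (Suc i)) As (u d)) +
      scale (\<phi>2 (Suc i)) (poly_endo scale (eta_poly d \<theta> i) As (u d))" if i: "i < d" for i
  proof -
    \<comment> \<open>The automorphism acts on maps, so the relation between vectors is first made one between maps.\<close>
    let ?P = "poly_endo scale (eta_poly d \<theta> (Suc i)) A \<circ> Es 0"
    let ?Q = "poly_endo scale (eta_poly d \<theta> i) A \<circ> Es 0"
    have PQ: "?P \<in> endo scale" "?Q \<in> endo scale"
      by (simp_all add: comp_in_endo poly_endo_in_endo A.X As.E)
    have "As (?P v) = scale (\<theta>s (Suc i)) (?P v) + scale (\<phi>2 (Suc i)) (?Q v)" for v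
    proof -
      define t where "t = coord scale d x 0 v"
      have "?P v = scale t (u (Suc i))" "?Q v = scale t (u i)"
        by (simp_all add: t_def As.E_eq_coord u_def endo_scale[OF poly_endo_in_endo[OF A.X]])
      then show ?thesis
        by (simp add: endo_scale[OF As.X] As_u[OF i] scale_right_distrib mult.commute)
    qed
    then have "As \<circ> ?P = (\<lambda>v. scale (\<theta>s (Suc i)) (?P v) + scale (\<phi>2 (Suc i)) (?Q v))" by auto
    then have "\<sigma> As \<circ> \<sigma> ?P
        = (\<lambda>v. scale (\<theta>s (Suc i)) (\<sigma> ?P v) + scale (\<phi>2 (Suc i)) (\<sigma> ?Q v))"
      using \<sigma>_comp[OF As.X PQ(1)] \<sigma>_add[OF scale_in_endo[OF PQ(1)] scale_in_endo[OF PQ(2)]]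
        \<sigma>_scale[OF PQ(1)] \<sigma>_scale[OF PQ(2)] by metis
    moreover have "\<sigma> ?P = poly_endo scale (eta_poly d \<theta> (Suc i)) As \<circ> E 0"
      "\<sigma> ?Q = poly_endo scale (eta_poly d \<theta> i) As \<circ> E 0"
      by (simp_all only: \<sigma>_comp poly_endo_in_endo A.X As.E \<sigma>_poly E_Es le0)
    ultimately show ?thesis by (simp add: fun_eq_iff A_As) (metis E_u_last)
  qed
qed

lemma eta_dual: "eta_poly d \<theta>s k = eta_poly d \<theta> k"
  by (simp add: eta_poly_def dual_eigenvalues_eq)

lemma tau_dual: "k \<le> d \<Longrightarrow> tau_poly \<theta>s k = tau_poly \<theta> k"
  by (simp add: tau_poly_def dual_eigenvalues_eq)

text \<open>The dual chain \<open>\<eta>\<^sub>i(A\<^sup>*) u\<^sub>d\<close> is the chain \<open>u\<close> run backwards, up to the scalars \<open>f i\<close>, whose successive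
  ratios are \<open>\<phi>2 (d - i)\<close>. The dual split relation gives the lowering coefficients of \<open>A\<close> on it as
  \<open>\<phi>2 (Suc i)\<close>; but on \<open>u\<close> itself the corresponding coefficients are \<open>1\<close>, so they must equal those
  ratios.\<close>

lemma phi_symmetric:
  assumes "i < d"
  shows "\<phi>2 (d - i) = \<phi>2 (Suc i)"
proof -
  define f where "f k = (\<Prod>h<k. \<phi>2 (d - h))" for k
  have f: "f i \<noteq> 0"
  proof -
    have "\<phi>2 (d - h) \<noteq> 0" if "h < i" for h
      using phi_nonzero[of "d - Suc h"] that assms by (simp add: Suc_diff_Suc)
    then show ?thesis by (simp add: f_def)
  qed
  have lad: "poly_endo scale (eta_poly d \<theta> k) As (u d) = scale (f k) (u (d - k))" if "k \<le> d" for k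
    using ladder_u[OF that] by (simp add: eta_dual f_def)
  have "scale (f (Suc i)) (A (u (d - Suc i)))
      = scale (\<theta>s (Suc i)) (scale (f (Suc i)) (u (d - Suc i))) + scale (\<phi>2 (Suc i)) (scale (f i) (u (d - i)))"
    using second_split_dual[OF assms] assms by (simp add: lad endo_scale[OF A.X])
  moreover have "A (u (d - Suc i)) = scale (\<theta>s (Suc i)) (u (d - Suc i)) + u (d - i)"
    using A_u[of "d - Suc i"] assms by (simp add: dual_eigenvalues_eq Suc_diff_Suc)
  ultimately have "scale (f (Suc i)) (u (d - i)) = scale (\<phi>2 (Suc i) * f i) (u (d - i))"
    by (simp add: scale_right_distrib mult.commute)
  moreover have "u (d - i) \<noteq> 0" using basis_family_nonzero[OF basis_u] by simp
  ultimately have "f (Suc i) = \<phi>2 (Suc i) * f i" by simp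
  then show ?thesis using f by (simp add: f_def)
qed

definition phis :: "nat \<Rightarrow> 'a" where "phis j = (\<Prod>h=1..j. \<phi>2 h)"

lemma phis_0: "phis 0 = 1" and phis_Suc: "phis (Suc j) = phis j * \<phi>2 (Suc j)"
  by (simp_all add: phis_def)

lemma phis_eq: "phis j = (\<Prod>h<j. \<phi>2 (Suc h))"
  by (simp add: phis_def prod.atLeast1_atMost_eq)

lemma phis_nonzero: "j \<le> d \<Longrightarrow> phis j \<noteq> 0"
  using phi_nonzero by (auto simp: phis_eq)

lemma eta_As_u: "k \<le> d \<Longrightarrow> poly_endo scale (eta_poly d \<theta>s k) As (u d) = scale (phis k) (u (d - k))"
  by (simp add: ladder_u phis_eq phi_symmetric)

lemma tau_As_w: "k \<le> d \<Longrightarrow> poly_endo scale (tau_poly \<theta>s k) As (w d) = scale (phis k) (w (d - k))"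
  by (simp add: ladder_w phis_eq)


section \<open>The intertwining map T\<close>

definition T :: "'b \<Rightarrow> 'b" where
  "T v = (\<Sum>i\<le>d. poly_endo scale (eta_poly d \<theta> (d - i)) A
      (Es 0 (E d (poly_endo scale (tau_poly \<theta>s i) As v))))"

lemma T_in_endo: "T \<in> endo scale"
proof -
  have "(\<lambda>v. \<Sum>i\<le>d. (poly_endo scale (eta_poly d \<theta> (d - i)) A \<circ> Es 0 \<circ> E d \<circ>
      poly_endo scale (tau_poly \<theta>s i) As) v) \<in> endo scale"
    by (intro sum_in_endo comp_in_endo poly_endo_in_endo A.X As.X A.E As.E) auto
  then show ?thesis by (simp add: T_def[abs_def])
qed

definition T_scalar :: 'a where
  "T_scalar = (\<Prod>h=1..d. \<phi>1 h) / (poly (tau_poly \<theta> d) (\<theta> d) * poly (eta_poly d \<theta> d) (\<theta> 0))"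

text \<open>\<open>E d\<close> is \<open>\<tau>\<^sub>d(A)\<close> divided by \<open>\<tau>\<^sub>d(\<theta>\<^sub>d)\<close>, and \<open>Es 0\<close> is \<open>\<eta>\<^sup>*\<^sub>d(A\<^sup>*)\<close> divided by its value at \<open>\<theta>s 0\<close>. Climbing the
  first split chain from \<open>x 0\<close> to its top and descending it again costs the product of the
  first split sequence.\<close>

lemma Es_E_x: "Es 0 (E d (x 0)) = scale T_scalar (x 0)"
proof -
  let ?t = "poly (tau_poly \<theta> d) (\<theta> d)" and ?e = "poly (eta_poly d \<theta> d) (\<theta> 0)"
  define y where "y k = poly_endo scale (tau_poly \<theta> k) A (x 0)" for k
  have y0: "y 0 = x 0"
    by (simp add: y_def tau_poly_def one_pCons poly_endo_pCons A.X endo_0[OF A.X])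
  have "y d = scale ?t (E d (x 0))"
    unfolding y_def by (rule A.poly_endo_eq_idempotent) (auto intro: poly_tau_eq_0)
  then have t: "Es 0 (y d) = scale ?t (Es 0 (E d (x 0)))"
    by (simp add: endo_scale[OF As.E])
  have "poly_endo scale (eta_poly d \<theta>s d) As (y d) = scale (\<Prod>h<d. \<phi>1 (d - h)) (y (d - d))"
    unfolding eta_poly_def
    by (rule poly_endo_ladder[OF As.X, where b = \<theta>s and f = \<phi>1]) (simp_all add: y_def first_split)
  moreover have "(\<Prod>h<d. \<phi>1 (d - h)) = (\<Prod>h=1..d. \<phi>1 h)"
    using prod.nat_diff_reindex[of "\<lambda>h. \<phi>1 (Suc h)" d]
    by (simp add: prod.atLeast1_atMost_eq Suc_diff_Suc)
  ultimately have "Es 0 (poly_endo scale (eta_poly d \<theta>s d) As (y d)) = scale (\<Prod>h=1..d. \<phi>1 h) (x 0)"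
    by (simp add: y0 endo_scale[OF As.E] As.E_b)
  then have e: "scale ?e (Es 0 (y d)) = scale (\<Prod>h=1..d. \<phi>1 h) (x 0)"
    by (simp add: As.E_poly eta_dual dual_eigenvalues_eq)
  have "scale (?t * ?e) (Es 0 (E d (x 0))) = scale (?t * ?e) (scale T_scalar (x 0))"
    using e A.poly_tau_last_nonzero A.poly_eta_first_nonzero
    by (simp add: t T_scalar_def mult.commute)
  then show ?thesis using A.poly_tau_last_nonzero A.poly_eta_first_nonzero
    by (metis mult_eq_0_iff scale_cancel_left)
qed

lemma E_u_pos:
  assumes "0 < k" "k \<le> d"
  shows "E d (u k) = 0"
  using assms by (simp add: u_def A.E_poly poly_eta_eq_0)

text \<open>Only the summand \<open>i = k\<close> of \<open>T\<close> survives on \<open>u k\<close>. For \<open>i < k\<close> the polynomial \<open>\<tau>\<^sup>*\<^sub>i\<close> cannot lower \<open>u k\<close> to \<open>u 0\<close>,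
  the one vector of the chain not killed by \<open>E d\<close>; for \<open>i > k\<close> it annihilates \<open>u k\<close>, which
  is a multiple of \<open>\<eta>\<^sup>*\<^sub>d\<^sub>-\<^sub>k(A\<^sup>*) u\<^sub>d\<close>, so that all eigenvalues of \<open>As\<close> occur among the roots.\<close>

lemma T_u:
  assumes "k \<le> d"
  shows "T (u k) = scale (T_scalar * phis k) (u (d - k))"
proof -
  have low: "E d (poly_endo scale (tau_poly \<theta>s i) As (u k)) = (if i = k then scale (phis k) (E d (x 0)) else 0)"
    if "i \<le> d" for i
  proof (cases "i \<le> k")
    case True
    define c where "c i j = (if i = j then \<theta>s j else if Suc i = j then \<phi>2 j else 0)" for i j
    have "E d (poly_endo scale (tau_poly \<theta>s i) As (u k))
        = scale (coeff (tau_poly \<theta>s i) k * (\<Prod>h<k. c h (Suc h))) (E d (u 0))"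
    proof (rule poly_endo_lowering[OF As.X A.E[OF order_refl], where d = d])
      fix k assume k: "k < d"
      have "(\<Sum>i\<le>d. scale (c i (Suc k)) (u i)) = (\<Sum>i\<in>{k, Suc k}. scale (c i (Suc k)) (u i))"
        by (rule sum.mono_neutral_right) (use k in \<open>auto simp: c_def\<close>)
      also have "\<dots> = As (u (Suc k))" using k by (simp add: As_u c_def add.commute)
      finally show "As (u (Suc k)) = (\<Sum>i\<le>d. scale (c i (Suc k)) (u i))" ..
    qed (use True assms in \<open>auto simp: c_def E_u_pos degree_tau\<close>)
    moreover have "coeff (tau_poly \<theta>s i) k = (if i = k then 1 else 0)"
      using True by (auto simp: lead_coeff_tau coeff_eq_0 degree_tau)
    ultimately show ?thesis by (simp add: c_def phis_eq u_0)
  next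
    case False
    \<comment> \<open>The roots are \<open>\<theta>s h\<close> for \<open>h < i\<close> and for \<open>k < h\<close>, hence all of them.\<close>
    let ?p = "tau_poly \<theta>s i * eta_poly d \<theta>s (d - k)"
    have "poly ?p (\<theta>s h) = 0" if "h \<le> d" for h
      using that False assms poly_tau_eq_0[of h i \<theta>s] poly_eta_eq_0[of h d "d - k" \<theta>s]
      by (cases "h < i") auto
    then have "poly_endo scale ?p As (u d) = 0" by (rule As.poly_endo_eq_0)
    then have "scale (phis (d - k)) (poly_endo scale (tau_poly \<theta>s i) As (u k)) = 0"
      using assms by (simp add: poly_endo_mult[OF As.X] eta_As_u endo_scale[OF poly_endo_in_endo[OF As.X]])
    then show ?thesis using phis_nonzero[of "d - k"] False by (simp add: endo_0[OF A.E])
  qed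
  have "T (u k) = (\<Sum>i\<le>d. if i = k then scale (T_scalar * phis k) (u (d - k)) else 0)"
    unfolding T_def
    by (rule sum.cong)
      (auto simp: low endo_scale[OF As.E] endo_0[OF As.E] endo_0[OF poly_endo_in_endo[OF A.X]]
        endo_scale[OF poly_endo_in_endo[OF A.X]] Es_E_x u_def[of "d - k"] mult.commute)
  with assms show ?thesis by simp
qed

text \<open>On the basis \<open>u\<close>, the raising coefficients \<open>1\<close> of \<open>A\<close> and the lowering coefficients \<open>\<phi>2\<close> of \<open>As\<close>
  are exchanged by reversing the order and rescaling with \<open>phis\<close>. In \<open>T A = A\<^sup>* T\<close> this requires
  that \<open>\<phi>2\<close> be symmetric.\<close>

lemma T_A: "T (A v) = As (T v)"
proof -
  have "(T \<circ> A) v = (As \<circ> T) v"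
  proof (rule endo_eq_on_basis[OF basis_u, where X = "T \<circ> A" and Z = "As \<circ> T"])
    fix j assume j: "j \<le> d"
    show "(T \<circ> A) (u j) = (As \<circ> T) (u j)"
    proof (cases "j = d")
      case True
      then show ?thesis
        by (simp add: A_u u_top T_u endo_scale[OF T_in_endo] endo_scale[OF As.X] As_u_0 dual_eigenvalues_eq
            mult.commute)
    next
      case False
      define l where "l = d - Suc j"
      have l: "d - j = Suc l" "l < d" "d - Suc j = l" "d - l = Suc j" using False j by (auto simp: l_def)
      have "\<phi>2 (Suc l) = \<phi>2 (Suc j)" using phi_symmetric[of l] l by simp
      then show ?thesis using l j False
        by (simp add: A_u T_u endo_scale[OF T_in_endo] endo_add[OF T_in_endo] endo_scale[OF As.X] As_u
            dual_eigenvalues_eq phis_Suc scale_right_distrib ac_simps)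
    qed
  qed (intro comp_in_endo T_in_endo A.X As.X)+
  then show ?thesis by simp
qed

lemma T_As: "T (As v) = A (T v)"
proof -
  have "(T \<circ> As) v = (A \<circ> T) v"
  proof (rule endo_eq_on_basis[OF basis_u, where X = "T \<circ> As" and Z = "A \<circ> T"])
    fix j assume j: "j \<le> d"
    show "(T \<circ> As) (u j) = (A \<circ> T) (u j)"
    proof (cases j)
      case 0
      then show ?thesis
        by (simp add: As_u_0 A_u u_top T_u endo_scale[OF T_in_endo] endo_scale[OF A.X]
            dual_eigenvalues_eq mult.commute)
    next
      case (Suc l)
      then have "Suc (d - Suc l) = d - l" using j by simp
      then show ?thesis using Suc j
        by (simp add: As_u A_u T_u endo_scale[OF T_in_endo] endo_add[OF T_in_endo] endo_scale[OF A.X]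
            dual_eigenvalues_eq phis_Suc scale_right_distrib ac_simps)
    qed
  qed (intro comp_in_endo T_in_endo A.X As.X)+
  then show ?thesis by simp
qed

text \<open>By the intertwining relations \<open>T (x 0)\<close> is an eigenvector of \<open>A\<close> for \<open>\<theta>s 0\<close>, just as \<open>x 0\<close> is one of
  \<open>As\<close>. For \<open>v = p(A) x\<^sub>0\<close>, and these are all vectors, both sides then equal
  \<open>p(\<theta>\<^sup>*\<^sub>0)\<close> times the value of the form at \<open>x 0\<close> and \<open>T (x 0)\<close>.\<close>

lemma form_T_x0: "form (x 0) (T v) = form (T (x 0)) v"
proof -
  have fx: "form (x 0) (As z) = \<theta>s 0 * form (x 0) z" for z
    by (simp add: form_As[symmetric] As.eig form_scale_left)
  have ATx: "A (T (x 0)) = scale (\<theta>s 0) (T (x 0))"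
    by (simp add: T_As[symmetric] As.eig endo_scale[OF T_in_endo])
  have gen: "form (x 0) (T (u j)) = form (T (x 0)) (u j)" for j
  proof -
    let ?p = "eta_poly d \<theta> j"
    have "form (x 0) (T (u j)) = form (x 0) (poly_endo scale ?p As (T (x 0)))"
      unfolding u_def by (simp only: poly_endo_intertwine[OF A.X As.X T_in_endo T_A])
    also have "\<dots> = form (poly_endo scale ?p A (T (x 0))) (x 0)"
    proof -
      have "form (x 0) (poly_endo scale q As z) = poly q (\<theta>s 0) * form (x 0) z" for q z
        by (induction q)
          (simp_all add: form_0_right poly_endo_pCons As.X form_add_right form_scale_right fx algebra_simps)
      moreover have "form (x 0) (T (x 0)) = form (T (x 0)) (x 0)"
        by (simp add: form_def ac_simps)
      ultimately show ?thesis
        by (simp only: poly_endo_eigenvector[OF A.X ATx] form_scale_left)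
    qed
    also have "\<dots> = form (T (x 0)) (u j)" by (simp add: u_def form_poly_A)
    finally show ?thesis .
  qed
  have "scale (form (x 0) (T v)) (x 0) = scale (form (T (x 0)) v) (x 0)"
    by (rule endo_eq_on_basis[OF basis_u, where X = "\<lambda>v. scale (form (x 0) (T v)) (x 0)"
          and Z = "\<lambda>v. scale (form (T (x 0)) v) (x 0)"])
      (auto intro!: endoI simp: endo_add[OF T_in_endo] endo_scale[OF T_in_endo] form_add_right
        form_scale_right scale_left_distrib gen)
  then show ?thesis using basis_family_nonzero[OF As.b, of 0] by simp
qed

text \<open>Intertwining puts \<open>T (x d)\<close> on the line of \<open>w d\<close>. Knowing that \<open>T \<circ> T\<close> is a scalar map would fix the
  factor up to its sign; comparing \<open>T (x d)\<close> with \<open>T (x 0)\<close> by means of the form fixes the factor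
  itself.\<close>

lemma T_x_last: "T (x d) = scale T_scalar (w d)"
proof -
  have "A (T (x d)) = scale (\<theta> d) (T (x d))"
    by (simp add: T_As[symmetric] As.eig endo_scale[OF T_in_endo] dual_eigenvalues_eq)
  then have 1: "E d (T (x d)) = T (x d)" by (intro A.eigenvector_eq_E) auto
  have w: "w d \<noteq> 0" using basis_family_nonzero[OF basis_w] by simp
  obtain c where c: "T (x d) = scale c (w d)"
  proof (cases "T (x d) = 0")
    case False
    show ?thesis
      by (rule A.range_E_multiple[of d "w d" "T (x d)"]) (use 1 E_w_last w False that in \<open>auto intro: range_eqI[OF sym]\<close>)
  qed (auto intro: that[of 0])
  have "form (x 0) (T (x d)) = c * pairing"
    using form_u_w[of 0 d] by (simp add: c form_scale_right u_0)
  moreover have "form (T (x 0)) (x d) = T_scalar * pairing"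
    using form_u_w[of d 0] T_u[of 0] by (simp add: u_0 w_0 phis_0 form_scale_left)
  ultimately have "c = T_scalar" using form_T_x0[of "x d"] pairing_nonzero by simp
  with c show ?thesis by simp
qed

lemma T_w:
  assumes "k \<le> d"
  shows "T (w k) = scale (T_scalar * phis k) (w (d - k))"
proof -
  have "T (w k) = poly_endo scale (tau_poly \<theta>s k) As (T (x d))"
    unfolding w_def tau_dual[OF assms] by (rule poly_endo_intertwine[OF A.X As.X T_in_endo T_A])
  then show ?thesis
    by (simp add: T_x_last endo_scale[OF poly_endo_in_endo[OF As.X]] tau_As_w assms)
qed

definition T_mat :: "'a mat" where
  "T_mat = T_scalar \<cdot>\<^sub>m mat (d + 1) (d + 1) (\<lambda>(i, j). if i = d - j then phis j else 0)"

lemma T_mat_represents: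
  assumes "basis_family scale d y" "\<And>j. j \<le> d \<Longrightarrow> T (y j) = scale (T_scalar * phis j) (y (d - j))"
  shows "represents scale d y T_mat T"
  unfolding represents_def
proof (intro conjI allI impI)
  fix j assume j: "j \<le> d"
  have "(\<Sum>i\<le>d. scale (T_mat $$ (i, j)) (y i)) = (\<Sum>i\<le>d. if i = d - j then scale (T_scalar * phis j) (y (d - j)) else 0)"
    by (rule sum.cong) (use j in \<open>auto simp: T_mat_def\<close>)
  then show "T (y j) = (\<Sum>i\<le>d. scale (T_mat $$ (i, j)) (y i))" using assms(2)[OF j] by simp
qed (use assms(1) in \<open>auto simp: T_mat_def\<close>)

text \<open>Reversing a basis and rescaling it with \<open>phis\<close> does not change the matrix: both sides pick up
  the factor \<open>phis j * phis (d - j)\<close>. This takes the bases made from \<open>A\<close> to those made from \<open>As\<close>.\<close>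

lemma T_mat_represents_reversed:
  assumes y: "basis_family scale d y" and T_y: "\<And>j. j \<le> d \<Longrightarrow> T (y j) = scale (T_scalar * phis j) (y (d - j))"
    and z: "\<And>j. j \<le> d \<Longrightarrow> z j = scale (phis j) (y (d - j))"
  shows "represents scale d z T_mat T"
proof (rule T_mat_represents)
  show "basis_family scale d z"
    by (rule basis_family_of_biorthogonal[OF y, where f = "\<lambda>i. coord scale d y (d - i)" and m = phis])
      (auto simp: coord_add[OF y] coord_scale[OF y] coord_basis[OF y] z phis_nonzero)
  show "T (z j) = scale (T_scalar * phis j) (z (d - j))" if "j \<le> d" for j
    using that by (simp add: z T_y endo_scale[OF T_in_endo] ac_simps)
qed

text \<open>Eigenspaces are lines, so another starting vector rescales the whole basis by one constant.\<close>

lemma T_mat_represents_scaled: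
  assumes "represents scale d (\<lambda>i. poly_endo scale (p i) X v) T_mat T" "X \<in> endo scale"
    and F: "eigen_system scale d X' \<theta>' F f" and "i \<le> d" "F i v = v" "z \<in> range (F i)" "z \<noteq> 0"
  shows "represents scale d (\<lambda>i. poly_endo scale (p i) X z) T_mat T"
proof -
  have "v \<noteq> 0"
  proof
    assume "v = 0"
    then have "poly_endo scale (p 0) X v = 0" by (simp add: endo_0[OF poly_endo_in_endo[OF assms(2)]])
    then show False using assms(1) basis_family_nonzero[of d "\<lambda>i. poly_endo scale (p i) X v" 0]
      by (simp add: represents_def)
  qed
  moreover have "v \<in> range (F i)" using assms(5) by (metis rangeI)
  ultimately obtain c where "c \<noteq> 0" "z = scale c v"
    using eigen_system.range_E_multiple[OF F assms(4)] assms(6,7) by metis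
  then show ?thesis
    using represents_scale[OF assms(1) T_in_endo, of c]
    by (simp add: endo_scale[OF poly_endo_in_endo[OF assms(2)]])
qed

end


theorem theorem15p3:
  fixes scale :: "'a::field \<Rightarrow> 'b::ab_group_add \<Rightarrow> 'b"
    and Basis :: "'b set"
    and d :: nat
    and A As T :: "'b \<Rightarrow> 'b"
    and E Es :: "nat \<Rightarrow> 'b \<Rightarrow> 'b"
    and \<theta> \<theta>s \<phi>1 \<phi>2 :: "nat \<Rightarrow> 'a"
    and v0 vd vs0 vsd :: 'b
    and M :: "'a mat"
  assumes "finite_dimensional_vector_space scale Basis"
    and "vector_space.dim scale (UNIV :: 'b set) > 0"
    and "leonard_system scale d A E As Es"
    and "self_dual scale d A E As Es"
    and "parameter_array scale d A E As Es \<theta> \<theta>s \<phi>1 \<phi>2"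
    and "v0 \<in> range (E 0)" "v0 \<noteq> 0"
    and "vd \<in> range (E d)" "vd \<noteq> 0"
    and "vs0 \<in> range (Es 0)" "vs0 \<noteq> 0"
    and "vsd \<in> range (Es d)" "vsd \<noteq> 0"
    and "T = (\<lambda>v. \<Sum>i\<le>d.
             (poly_endo scale (eta_poly d \<theta> (d - i)) A \<circ> Es 0 \<circ> E d \<circ>
              poly_endo scale (tau_poly \<theta>s i) As) v)"
    and "M = ((\<Prod>h=1..d. \<phi>1 h) / (poly (tau_poly \<theta> d) (\<theta> d) * poly (eta_poly d \<theta> d) (\<theta> 0)))
             \<cdot>\<^sub>m mat (d + 1) (d + 1) (\<lambda>(i, j). if i = d - j then \<Prod>h=1..j. \<phi>2 h else 0)"
  shows "represents scale d (\<lambda>i. poly_endo scale (eta_poly d \<theta>s i) As v0) M T \<and>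
         represents scale d (\<lambda>i. poly_endo scale (eta_poly d \<theta> i) A vs0) M T \<and>
         represents scale d (\<lambda>i. poly_endo scale (tau_poly \<theta>s i) As vd) M T \<and>
         represents scale d (\<lambda>i. poly_endo scale (tau_poly \<theta> i) A vsd) M T"
proof -
  interpret V: finite_dimensional_vector_space scale Basis by fact
  have lp: "leonard_pair scale A As" and std: "standard_ordering scale d A As E" "standard_ordering scale d As A Es"
    using assms(3) by (auto simp: leonard_system_def)
  have endo: "A \<in> endo scale" "As \<in> endo scale" using lp by (auto simp: leonard_pair_def)
  have par: "\<And>i. i \<le> d \<Longrightarrow> primitive_idempotent_for scale A (\<theta> i) (E i)"
    "\<And>i. i \<le> d \<Longrightarrow> primitive_idempotent_for scale As (\<theta>s i) (Es i)"
    "split_sequence scale d A As Es (tau_poly \<theta>) \<theta>s \<phi>1"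
    "split_sequence scale d A As Es (eta_poly d \<theta>) \<theta>s \<phi>2"
    using assms(5) by (auto simp: parameter_array_def)
  obtain e z D where "represents scale e z D A" "diagonal_mat D"
    using lp unfolding leonard_pair_def by blast
  then obtain b where b: "eigen_system scale d A \<theta> E b"
    by (rule V.standard_ordering_eigenbasis[OF endo(1) _ _ par(1) std(1)])
  obtain e z D where "represents scale e z D As" "diagonal_mat D"
    using lp unfolding leonard_pair_def by blast
  then obtain x Y where x: "eigen_system scale d As \<theta>s Es x"
    and Y: "represents scale d x Y A" "irreducible_tridiagonal_mat Y"
    by (rule V.standard_ordering_eigenbasis[OF endo(2) _ _ par(2) std(2)])
  interpret b: eigen_system scale d A \<theta> E b by (rule b)
  interpret x: eigen_system scale d As \<theta>s Es x by (rule x)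
  have x0: "x 0 \<in> range (Es 0)" "x 0 \<noteq> 0"
    using x.E_b[of 0 0] V.basis_family_nonzero[OF x.b, of 0] by (auto intro: range_eqI[OF sym])
  have dim: "dim_row Y = Suc d" "dim_col Y = Suc d" using Y(1) by (auto simp: represents_def)
  interpret L: self_dual_leonard_array scale Basis d A \<theta> E b As \<theta>s Es x Y \<phi>1 \<phi>2
  proof unfold_locales
    fix i assume "i < d"
    then have i: "Suc i \<in> {1..d}" by simp
    show "As (poly_endo scale (tau_poly \<theta> (Suc i)) A (x 0)) =
      scale (\<theta>s (Suc i)) (poly_endo scale (tau_poly \<theta> (Suc i)) A (x 0)) +
      scale (\<phi>1 (Suc i)) (poly_endo scale (tau_poly \<theta> i) A (x 0))"
      using par(3) x0 i unfolding split_sequence_def by fastforce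
    show "As (poly_endo scale (eta_poly d \<theta> (Suc i)) A (x 0)) =
      scale (\<theta>s (Suc i)) (poly_endo scale (eta_poly d \<theta> (Suc i)) A (x 0)) +
      scale (\<phi>2 (Suc i)) (poly_endo scale (eta_poly d \<theta> i) A (x 0))"
      using par(4) x0 i unfolding split_sequence_def by fastforce
    show "\<phi>2 (Suc i) \<noteq> 0" using par(4) i unfolding split_sequence_def by blast
    show "Y $$ (Suc i, i) \<noteq> 0 \<and> Y $$ (i, Suc i) \<noteq> 0"
      using Y(2) \<open>i < d\<close> dim by (auto simp: irreducible_tridiagonal_mat_def)
  next
    fix i j assume "i \<le> d" "j \<le> d" "Y $$ (i, j) \<noteq> 0"
    then show "i = j \<or> i = Suc j \<or> j = Suc i"
      using Y(2) dim by (auto simp: irreducible_tridiagonal_mat_def tridiagonal_mat_def)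
  qed (use Y(1) assms(4) in \<open>auto simp: represents_def\<close>)
  have T: "T = L.T" by (simp add: assms(14) L.T_def[abs_def])
  have M: "M = L.T_mat" by (simp only: assms(15) L.T_mat_def L.T_scalar_def L.phis_def)
  have u: "represents scale d L.u L.T_mat L.T" by (rule L.T_mat_represents[OF L.basis_u L.T_u])
  have w: "represents scale d L.w L.T_mat L.T" by (rule L.T_mat_represents[OF L.basis_w L.T_w])
  have eta: "represents scale d (\<lambda>i. poly_endo scale (eta_poly d \<theta>s i) As (L.u d)) L.T_mat L.T"
    by (rule L.T_mat_represents_reversed[OF L.basis_u L.T_u L.eta_As_u])
  have tau: "represents scale d (\<lambda>i. poly_endo scale (tau_poly \<theta>s i) As (L.w d)) L.T_mat L.T"
    by (rule L.T_mat_represents_reversed[OF L.basis_w L.T_w L.tau_As_w])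
  show ?thesis unfolding T M
  proof (intro conjI)
    show "represents scale d (\<lambda>i. poly_endo scale (eta_poly d \<theta>s i) As v0) L.T_mat L.T"
      by (rule L.T_mat_represents_scaled[OF eta endo(2) b le0 L.E_u_last assms(6,7)])
    show "represents scale d (\<lambda>i. poly_endo scale (eta_poly d \<theta> i) A vs0) L.T_mat L.T"
      by (rule L.T_mat_represents_scaled[OF u[unfolded L.u_def[abs_def]] endo(1) x le0 _ assms(10,11)])
        (simp add: x.E_b)
    show "represents scale d (\<lambda>i. poly_endo scale (tau_poly \<theta>s i) As vd) L.T_mat L.T"
      by (rule L.T_mat_represents_scaled[OF tau endo(2) b order_refl L.E_w_last assms(8,9)])
    show "represents scale d (\<lambda>i. poly_endo scale (tau_poly \<theta> i) A vsd) L.T_mat L.T"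
      by (rule L.T_mat_represents_scaled[OF w[unfolded L.w_def[abs_def]] endo(1) x order_refl _ assms(12,13)])
        (simp add: x.E_b)
  qed
qed

end
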